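(* Let $\mathcal{X}$ be an infinite-dimensional real Banach space and let $\mathcal{A}\subset\mathcal{B}(\mathcal{X})$ be an $L$-algebra. Then: (i) $\mathcal{A}$ is dense if and only if it is of real type. (ii) $\mathcal{A}$ is $(1/2)$-dense but not dense if and only if it is of complex type. (iii) $\mathcal{A}$ is $(1/4)$-dense but neither dense nor $(1/2)$-dense if and only if it is of quaternion type.
   Context: $\mathcal{B}(\mathcal{X})$ denotes the algebra of all bounded linear operators on $\mathcal{X}$. An algebra of operators on $\mathcal{X}$ is a (real) subalgebra of $\mathcal{B}(\mathcal{X})$, not assumed unital or closed. It is transitive if for any $\varepsilon>0$ and any $x,y\in\mathcal{X}$ with $x\neq 0$ there is $T\in\mathcal{A}$ with $\|Tx-y\|<\varepsilon$ (equivalently, it has no non-trivial closed invariant subspaces). An $L$-algebra is a transitive algebra of operators on $\mathcal{X}$ that contains a non-zero finite rank operator. For an $L$-algebra $\mathcal{A}$, $\mathcal{A}^F$ is the set of all finite rank operators in $\mathcal{A}$, and $\mathcal{X}^F=\mathrm{lin}\{Tx: T\in\mathcal{A}^F, x\in\mathcal{X}\}$ (a dense $\mathcal{A}$-invariant linear subspace). $\mathbb{D}$ is the algebra of all linear operators $\mathcal{X}^F\to\mathcal{X}^F$ (not assumed bounded) commuting with the restrictions to $\mathcal{X}^F$ of all operators in $\mathcal{A}^F$; it is always a finite-dimensional real division algebra, hence isomorphic to $\mathbb{R}$, $\mathbb{C}$ or the quaternions $\mathbb{H}$. $\mathcal{A}$ is of real, complex or quaternion type if $\mathbb{D}$ is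 isomorphic to $\mathbb{R}$, $\mathbb{C}$ or $\mathbb{H}$, respectively. An algebra $\mathcal{A}$ is dense if for any $\varepsilon>0$, each finite linearly independent family $(x_1,\dots,x_n)\subset\mathcal{X}$ and any family $(y_1,\dots,y_n)\subset\mathcal{X}$ there is $T\in\mathcal{A}$ with $\|Tx_i-y_i\|<\varepsilon$, $i=1,\dots,n$. For $k\in\mathbb{N}$, $\mathcal{A}$ is $(1/k)$-dense if for any $\varepsilon>0$, any $n\ge1$, every linearly independent family $(x_1,\dots,x_{kn})\subset\mathcal{X}$ and any family $(y_1,\dots,y_n)\subset\mathcal{X}$, there are $j_1,\dots,j_n\in\{1,\dots,kn\}$ and $T\in\mathcal{A}$ with $\|y_i-Tx_{j_i}\|<\varepsilon$ for $1\le i\le n$. *)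

theory Defs
  imports "HOL-Analysis.Analysis"
begin

datatype quat = Quat (q_re: real) (q_i: real) (q_j: real) (q_k: real)

instantiation quat :: real_algebra_1
begin

definition "0 = Quat 0 0 0 0"

definition "1 = Quat 1 0 0 0"

definition "p + q = Quat (q_re p + q_re q) (q_i p + q_i q) (q_j p + q_j q) (q_k p + q_k q)"

definition "p - q = Quat (q_re p - q_re q) (q_i p - q_i q) (q_j p - q_j q) (q_k p - q_k q)"

definition "- p = Quat (- q_re p) (- q_i p) (- q_j p) (- q_k p)"

definition "c *\<^sub>R p = Quat (c * q_re p) (c * q_i p) (c * q_j p) (c * q_k p)"

definition "p * q = Quat
  (q_re p * q_re q - q_i p * q_i q - q_j p * q_j q - q_k p * q_k q)
  (q_re p * q_i q + q_i p * q_re q + q_j p * q_k q - q_k p * q_j q)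
  (q_re p * q_j q - q_i p * q_k q + q_j p * q_re q + q_k p * q_i q)
  (q_re p * q_k q + q_i p * q_j q - q_j p * q_i q + q_k p * q_re q)"

instance
  by standard
    (simp_all add: zero_quat_def one_quat_def plus_quat_def minus_quat_def uminus_quat_def
      scaleR_quat_def times_quat_def algebra_simps)

end

definition finite_dimensional :: "'a::real_vector set \<Rightarrow> bool" where
  "finite_dimensional V \<longleftrightarrow> (\<exists>B. finite B \<and> V \<subseteq> span B)"

definition independent_family :: "nat set \<Rightarrow> (nat \<Rightarrow> 'a::real_vector) \<Rightarrow> bool" where
  "independent_family I x \<longleftrightarrow> inj_on x I \<and> independent (x ` I)"

definition operator_algebra :: "('a::real_normed_vector \<Rightarrow>\<^sub>L 'a) set \<Rightarrow> bool" where
  "operator_algebra A \<longleftrightarrow> subspace A \<and> (\<forall>S\<in>A. \<forall>T\<in>A. S o\<^sub>L T \<in> A)"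

definition transitive_algebra :: "('a::real_normed_vector \<Rightarrow>\<^sub>L 'a) set \<Rightarrow> bool" where
  "transitive_algebra A \<longleftrightarrow> operator_algebra A \<and>
     (\<forall>\<epsilon>>0. \<forall>x y. x \<noteq> 0 \<longrightarrow> (\<exists>T\<in>A. norm (blinfun_apply T x - y) < \<epsilon>))"

definition finite_rank :: "('a::real_normed_vector \<Rightarrow>\<^sub>L 'b::real_normed_vector) \<Rightarrow> bool" where
  "finite_rank T \<longleftrightarrow> finite_dimensional (range (blinfun_apply T))"

definition L_algebra :: "('a::real_normed_vector \<Rightarrow>\<^sub>L 'a) set \<Rightarrow> bool" where
  "L_algebra A \<longleftrightarrow> transitive_algebra A \<and> (\<exists>T\<in>A. T \<noteq> 0 \<and> finite_rank T)"

definition finite_rank_part :: "('a::real_normed_vector \<Rightarrow>\<^sub>L 'a) set \<Rightarrow> ('a \<Rightarrow>\<^sub>L 'a) set" where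
  "finite_rank_part A = {T \<in> A. finite_rank T}"

definition finite_rank_space :: "('a::real_normed_vector \<Rightarrow>\<^sub>L 'a) set \<Rightarrow> 'a set" where
  "finite_rank_space A = span {blinfun_apply T x | T x. T \<in> finite_rank_part A}"

text \<open>A linear operator on the subspace \<open>finite_rank_space A\<close> is represented by a function on the
  whole type which takes the value \<open>undefined\<close> off the subspace, so that equality of functions is
  equality of operators.\<close>

definition finite_rank_commutant :: "('a::real_normed_vector \<Rightarrow>\<^sub>L 'a) set \<Rightarrow> ('a \<Rightarrow> 'a) set" where
  "finite_rank_commutant A =
    {f \<in> finite_rank_space A \<rightarrow>\<^sub>E finite_rank_space A.
      (\<forall>x\<in>finite_rank_space A. \<forall>y\<in>finite_rank_space A. f (x + y) = f x + f y) \<and>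
      (\<forall>c. \<forall>x\<in>finite_rank_space A. f (c *\<^sub>R x) = c *\<^sub>R f x) \<and>
      (\<forall>T\<in>finite_rank_part A. \<forall>x\<in>finite_rank_space A.
        f (blinfun_apply T x) = blinfun_apply T (f x))}"

definition commutant_isomorphism ::
  "('a::real_normed_vector \<Rightarrow>\<^sub>L 'a) set \<Rightarrow> ('d::real_algebra_1 \<Rightarrow> 'a \<Rightarrow> 'a) \<Rightarrow> bool" where
  "commutant_isomorphism A \<phi> \<longleftrightarrow>
     bij_betw \<phi> UNIV (finite_rank_commutant A) \<and>
     (\<forall>p q. \<phi> (p + q) = (\<lambda>x\<in>finite_rank_space A. \<phi> p x + \<phi> q x)) \<and>
     (\<forall>c p. \<phi> (c *\<^sub>R p) = (\<lambda>x\<in>finite_rank_space A. c *\<^sub>R \<phi> p x)) \<and>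
     (\<forall>p q. \<phi> (p * q) = compose (finite_rank_space A) (\<phi> p) (\<phi> q))"

definition real_type :: "('a::real_normed_vector \<Rightarrow>\<^sub>L 'a) set \<Rightarrow> bool" where
  "real_type A \<longleftrightarrow> (\<exists>\<phi> :: real \<Rightarrow> 'a \<Rightarrow> 'a. commutant_isomorphism A \<phi>)"

definition complex_type :: "('a::real_normed_vector \<Rightarrow>\<^sub>L 'a) set \<Rightarrow> bool" where
  "complex_type A \<longleftrightarrow> (\<exists>\<phi> :: complex \<Rightarrow> 'a \<Rightarrow> 'a. commutant_isomorphism A \<phi>)"

definition quaternion_type :: "('a::real_normed_vector \<Rightarrow>\<^sub>L 'a) set \<Rightarrow> bool" where
  "quaternion_type A \<longleftrightarrow> (\<exists>\<phi> :: quat \<Rightarrow> 'a \<Rightarrow> 'a. commutant_isomorphism A \<phi>)"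

definition dense_algebra :: "('a::real_normed_vector \<Rightarrow>\<^sub>L 'a) set \<Rightarrow> bool" where
  "dense_algebra A \<longleftrightarrow>
     (\<forall>\<epsilon>>0. \<forall>n. \<forall>x y :: nat \<Rightarrow> 'a. independent_family {1..n} x \<longrightarrow>
       (\<exists>T\<in>A. \<forall>i\<in>{1..n}. norm (blinfun_apply T (x i) - y i) < \<epsilon>))"

text \<open>The indices \<open>j 1, \<dots>, j n\<close> are not required to be distinct.\<close>

definition frac_dense :: "nat \<Rightarrow> ('a::real_normed_vector \<Rightarrow>\<^sub>L 'a) set \<Rightarrow> bool" where
  "frac_dense k A \<longleftrightarrow>
     (\<forall>\<epsilon>>0. \<forall>n\<ge>1. \<forall>x y :: nat \<Rightarrow> 'a. independent_family {1..k * n} x \<longrightarrow>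
       (\<exists>j \<in> {1..n} \<rightarrow> {1..k * n}. \<exists>T\<in>A.
         \<forall>i\<in>{1..n}. norm (y i - blinfun_apply T (x (j i))) < \<epsilon>))"

end

theory Submission
  imports Defs "HOL-Computational_Algebra.Fundamental_Theorem_Algebra"
begin

text \<open>Let \<open>F\<close> be the ideal of finite rank operators of the L-algebra \<open>A\<close>, \<open>V\<close> the span of their ranges
  and \<open>D\<close> the algebra of operators on \<open>V\<close> that commute with \<open>F\<close>.

  Transitivity gives only approximate solutions of \<open>T x = y\<close>, but a finite-dimensional range is closed,
  so on finite rank operators approximation becomes equality: \<open>{T x | T \<in> F} = V\<close> for every \<open>x \<noteq> 0\<close>
  of the whole space (\<open>F_orbit\<close>). Hence \<open>V\<close> is a simple \<open>F\<close>-module and, by Schur's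
  argument, \<open>D\<close> has no zero divisors; evaluating at a nonzero vector of the range of one \<open>T \<in> F\<close>
  embeds \<open>D\<close> linearly into that range, so \<open>D\<close> is finite-dimensional. By Frobenius' theorem (\<open>frobenius\<close>)
  \<open>D\<close> is the real field, the complex field or the quaternions, so \<open>A\<close> has one of the three types.

  It remains to read the density off the dimension of \<open>D\<close>.

  For the positive half, a maximal subfamily \<open>J\<close> of an independent family on which \<open>F\<close> can take arbitrary values in \<open>V\<close>
  determines the rest \<open>D\<close>-linearly: each \<open>x\<^sub>l\<close> satisfies \<open>T x\<^sub>l = \<Sum>\<^sub>j c\<^sub>j (T x\<^sub>j)\<close> for all \<open>T \<in> F\<close>,
  with \<open>c\<^sub>j \<in> D\<close>, as in Jacobson's density theorem. Counting real
  coefficients, the family has at most \<open>dim D\<close> times as many members as \<open>J\<close>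
  (\<open>large_F_independent_subfamily\<close>). As \<open>V\<close> is dense, \<open>A\<close> is
  \<open>1/k\<close>-dense for \<open>k = dim D\<close>, and dense if \<open>k = 1\<close>.

  For the negative half, if \<open>D\<close> contains independent \<open>d\<^sub>1, \<dots>, d\<^sub>2\<^sub>l\<close>, then the vectors \<open>d\<^sub>i u\<close> with \<open>0 \<noteq> u \<in> V\<close> are independent,
  but for \<open>S \<in> F\<close> the vector \<open>S T d\<^sub>i u = d\<^sub>i (S T u)\<close> determines all the others by maps of a finite-dimensional
  space. So two of the \<open>T d\<^sub>i u\<close> cannot approximate \<open>0\<close> and a vector outside the kernel of \<open>S\<close>, and
  \<open>A\<close> is not \<open>1/l\<close>-dense (\<open>not_frac_dense_if_commutant_large\<close>).

  So the density conditions in the three equivalences hold for the right type and exclude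
  the other two types; as one of the types always occurs, the converses follow.\<close>

section \<open>Linear dependence\<close>

text \<open>Gaussian elimination: an equation with a nonzero coefficient eliminates one unknown \<open>p\<close>.\<close>

lemma homogeneous_system_nontrivial:
  fixes a :: "'i \<Rightarrow> 'e \<Rightarrow> real"
  assumes "finite E" "finite I" "card E < card I"
  shows "\<exists>t. (\<exists>l\<in>I. t l \<noteq> 0) \<and> (\<forall>e\<in>E. (\<Sum>l\<in>I. t l * a l e) = 0)"
  using assms
proof (induction E arbitrary: I a rule: finite_induct)
  case empty
  then obtain l where "l \<in> I" by fastforce
  then show ?case by (intro exI[of _ "\<lambda>_. 1"]) auto
next
  case (insert e E)
  show ?case
  proof (cases "\<forall>l\<in>I. a l e = 0")
    case True
    have "card E < card I" using insert by auto
    then obtain t where "\<exists>l\<in>I. t l \<noteq> 0" "\<forall>e\<in>E. (\<Sum>l\<in>I. t l * a l e) = 0"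
      using insert.IH[of I a] insert.prems by auto
    then show ?thesis using True by (intro exI[of _ t]) auto
  next
    case False
    then obtain p where p: "p \<in> I" "a p e \<noteq> 0" by auto
    define a' where "a' l f = a l f - a l e / a p e * a p f" for l f
    have "card E < card (I - {p})" using insert p by auto
    then obtain t where t: "\<exists>l\<in>I - {p}. t l \<noteq> 0"
        "\<forall>f\<in>E. (\<Sum>l\<in>I - {p}. t l * a' l f) = 0"
      using insert.IH[of "I - {p}" a'] insert.prems by auto
    define s where "s = (\<Sum>l\<in>I - {p}. t l * (a l e / a p e))"
    have s_f: "s * a p f = (\<Sum>l\<in>I - {p}. t l * (a l e / a p e * a p f))" for f
      unfolding s_def sum_distrib_right by (rule sum.cong) (simp_all only: mult.assoc)
    have split: "(\<Sum>l\<in>I. (t(p := - s)) l * a l f) = (\<Sum>l\<in>I - {p}. t l * a' l f)" for f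
    proof -
      have "(\<Sum>l\<in>I. (t(p := - s)) l * a l f) = - s * a p f + (\<Sum>l\<in>I - {p}. t l * a l f)"
        using p insert.prems by (simp add: sum.remove[of I p])
      also have "\<dots> = (\<Sum>l\<in>I - {p}. t l * a' l f)"
        unfolding a'_def right_diff_distrib sum_subtractf by (simp add: s_f)
      finally show ?thesis .
    qed
    have "(\<Sum>l\<in>I - {p}. t l * a' l e) = 0"
      using p by (simp add: a'_def)
    then show ?thesis
      using t split by (intro exI[of _ "t(p := - s)"]) auto
  qed
qed

lemma dependent_relation_in_finite_span:
  fixes x :: "'i \<Rightarrow> 'v::real_vector"
  assumes "finite B" "finite I" "card B < card I" "\<And>i. i \<in> I \<Longrightarrow> x i \<in> span B"
  shows "\<exists>t. (\<exists>i\<in>I. t i \<noteq> 0) \<and> (\<Sum>i\<in>I. t i *\<^sub>R x i) = 0"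
proof -
  have "\<forall>i\<in>I. \<exists>a. x i = (\<Sum>b\<in>B. a b *\<^sub>R b)"
    using assms span_finite[OF assms(1)] by force
  then obtain a where a: "\<And>i. i \<in> I \<Longrightarrow> x i = (\<Sum>b\<in>B. a i b *\<^sub>R b)" by metis
  obtain t where t: "\<exists>i\<in>I. t i \<noteq> 0" "\<forall>b\<in>B. (\<Sum>i\<in>I. t i * a i b) = 0"
    using homogeneous_system_nontrivial[OF assms(1-3), of a] by auto
  have "(\<Sum>i\<in>I. t i *\<^sub>R x i) = (\<Sum>i\<in>I. \<Sum>b\<in>B. (t i * a i b) *\<^sub>R b)"
    by (simp add: a scaleR_sum_right)
  also have "\<dots> = (\<Sum>b\<in>B. (\<Sum>i\<in>I. t i * a i b) *\<^sub>R b)"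
    by (subst sum.swap) (simp add: scaleR_sum_left)
  also have "\<dots> = 0" using t by simp
  finally show ?thesis using t by blast
qed

lemma independent_family_iff:
  fixes x :: "nat \<Rightarrow> 'v::real_vector"
  assumes "finite I"
  shows "independent_family I x \<longleftrightarrow>
    (\<forall>t. (\<Sum>i\<in>I. t i *\<^sub>R x i) = 0 \<longrightarrow> (\<forall>i\<in>I. t i = 0))"
proof
  assume *: "independent_family I x"
  then have inj: "inj_on x I" and ind: "independent (x ` I)" by (auto simp: independent_family_def)
  show "\<forall>t. (\<Sum>i\<in>I. t i *\<^sub>R x i) = 0 \<longrightarrow> (\<forall>i\<in>I. t i = 0)"
  proof (intro allI impI ballI)
    fix t i assume t: "(\<Sum>i\<in>I. t i *\<^sub>R x i) = 0" and i: "i \<in> I"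
    have "(\<Sum>v\<in>x ` I. t (the_inv_into I x v) *\<^sub>R v) = 0"
      using t by (subst sum.reindex[OF inj]) (simp add: the_inv_into_f_f[OF inj])
    then have "t (the_inv_into I x (x i)) = 0"
      using ind assms i independentD[OF ind, of "x ` I" "\<lambda>v. t (the_inv_into I x v)" "x i"] by auto
    then show "t i = 0" using i inj by (simp add: the_inv_into_f_f)
  qed
next
  assume *: "\<forall>t. (\<Sum>i\<in>I. t i *\<^sub>R x i) = 0 \<longrightarrow> (\<forall>i\<in>I. t i = 0)"
  have inj: "inj_on x I"
  proof (rule inj_onI, rule ccontr)
    fix i j assume ij: "i \<in> I" "j \<in> I" "x i = x j" "i \<noteq> j"
    define t :: "nat \<Rightarrow> real" where "t l = (if l = i then 1 else if l = j then - 1 else 0)" for l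
    have "(\<Sum>l\<in>I. t l *\<^sub>R x l) = (\<Sum>l\<in>{i, j}. t l *\<^sub>R x l)"
      using assms ij by (intro sum.mono_neutral_right) (auto simp: t_def)
    also have "\<dots> = 0" using ij by (simp add: t_def)
    finally show False using * ij by (metis t_def zero_neq_one)
  qed
  have "independent (x ` I)"
    unfolding independent_explicit_finite_subsets
  proof (intro allI impI ballI)
    fix S u v
    assume S: "S \<subseteq> x ` I" "finite S" "(\<Sum>v\<in>S. u v *\<^sub>R v) = 0" "v \<in> S"
    define t where "t i = (if x i \<in> S then u (x i) else 0)" for i
    have "(\<Sum>i\<in>I. t i *\<^sub>R x i) = (\<Sum>w\<in>x ` I. (if w \<in> S then u w else 0) *\<^sub>R w)"
      by (subst sum.reindex[OF inj]) (simp add: t_def)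
    also have "\<dots> = (\<Sum>w\<in>S. (if w \<in> S then u w else 0) *\<^sub>R w)"
      using S assms by (intro sum.mono_neutral_right) auto
    also have "\<dots> = 0" using S by simp
    finally show "u v = 0" using * S by (metis (no_types, lifting) imageE subsetD t_def)
  qed
  with inj show "independent_family I x" by (simp add: independent_family_def)
qed

lemma independent_family_subset:
  assumes "independent_family I x" "J \<subseteq> I"
  shows "independent_family J x"
  using assms unfolding independent_family_def
  by (meson image_mono independent_mono inj_on_subset)

section \<open>Finite-dimensional subspaces of a normed space\<close>

text \<open>The coefficient of \<open>b\<close> is a functional with closed kernel \<open>S\<close>, hence bounded: \<open>\<delta>\<close> is the radius of a ball
  around \<open>b\<close> that avoids \<open>S\<close>.\<close>

lemma coefficient_le_norm:
  assumes cl: "closed S" and S: "subspace S" and b: "b \<notin> S"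
  shows "\<exists>\<delta>>0. \<forall>a. \<forall>y\<in>S. \<delta> * \<bar>a\<bar> \<le> norm (a *\<^sub>R b + y :: 'v::real_normed_vector)"
proof -
  have "open (- S)" "b \<in> - S" using assms by auto
  then obtain \<delta> where d: "\<delta> > 0" "\<And>y. dist y b < \<delta> \<Longrightarrow> y \<notin> S"
    unfolding open_dist by auto
  have "\<delta> * \<bar>a\<bar> \<le> norm (a *\<^sub>R b + y)" if y: "y \<in> S" for a y
  proof (cases "a = 0")
    case False
    have "- (1 / a) *\<^sub>R y \<in> S" using y S subspace_mul by blast
    have "(- (1 / a)) *\<^sub>R y \<in> S" using y S subspace_mul by blast
    then have "\<delta> \<le> norm ((- (1 / a)) *\<^sub>R y - b)"
      using d(2)[of "(- (1 / a)) *\<^sub>R y"] by (fastforce simp: dist_norm not_less)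
    moreover have "(- (1 / a)) *\<^sub>R y - b = (- (1 / a)) *\<^sub>R (a *\<^sub>R b + y)"
      using False by (simp add: algebra_simps)
    ultimately have "\<delta> \<le> norm (a *\<^sub>R b + y) / \<bar>a\<bar>"
      using norm_scaleR[of "- (1 / a)" "a *\<^sub>R b + y"] by simp
    then show ?thesis using False by (simp add: field_simps)
  qed simp
  with d show ?thesis by blast
qed

text \<open>Adding one vector \<open>b\<close> to a closed span, \<open>coefficient_le_norm\<close> turns a convergent sequence of sums into a Cauchy
  sequence of coefficients of \<open>b\<close>, so that both summands converge.\<close>

lemma closed_span_finite:
  fixes B :: "'v::real_normed_vector set"
  assumes "finite B"
  shows "closed (span B)"
  using assms
proof (induction B rule: finite_induct)
  case empty
  then show ?case by simp
next
  case (insert b B)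
  show ?case
  proof (cases "b \<in> span B")
    case True
    then show ?thesis using insert by (simp add: span_redundant)
  next
    case False
    obtain \<delta> where d: "\<delta> > 0"
      "\<And>a y. y \<in> span B \<Longrightarrow> \<delta> * \<bar>a\<bar> \<le> norm (a *\<^sub>R b + y)"
      using coefficient_le_norm[OF insert.IH subspace_span False] by blast
    show ?thesis
      unfolding closed_sequential_limits
    proof (intro allI impI)
      fix z l assume z: "(\<forall>n. z n \<in> span (insert b B)) \<and> z \<longlonglongrightarrow> l"
      then have "\<forall>n. \<exists>a. z n - a *\<^sub>R b \<in> span B" by (simp add: span_breakdown_eq)
      then obtain a where a: "\<And>n. z n - a n *\<^sub>R b \<in> span B" by metis
      have "Cauchy z" using z by (auto intro: LIMSEQ_imp_Cauchy)
      have "Cauchy a"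
      proof (rule metric_CauchyI)
        fix e :: real assume "0 < e"
        then obtain N where N: "\<And>m n. m \<ge> N \<Longrightarrow> n \<ge> N \<Longrightarrow> dist (z m) (z n) < \<delta> * e"
          using metric_CauchyD[OF \<open>Cauchy z\<close> mult_pos_pos[OF d(1)]] by blast
        show "\<exists>N. \<forall>m\<ge>N. \<forall>n\<ge>N. dist (a m) (a n) < e"
        proof (intro exI allI impI)
          fix m n assume mn: "N \<le> m" "N \<le> n"
          have "\<delta> * \<bar>a m - a n\<bar> \<le>
            norm ((a m - a n) *\<^sub>R b + ((z m - a m *\<^sub>R b) - (z n - a n *\<^sub>R b)))"
            by (rule d(2)[OF span_diff[OF a a]])
          also have "\<dots> = dist (z m) (z n)" by (simp add: dist_norm algebra_simps)
          also have "\<dots> < \<delta> * e" using N mn by auto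
          finally show "dist (a m) (a n) < e" using d by (simp add: dist_real_def)
        qed
      qed
      then obtain c where "a \<longlonglongrightarrow> c" using Cauchy_convergent convergent_def by blast
      then have "(\<lambda>n. z n - a n *\<^sub>R b) \<longlonglongrightarrow> l - c *\<^sub>R b"
        using z by (intro tendsto_intros) auto
      then have "l - c *\<^sub>R b \<in> span B"
        by (rule closed_sequentially[OF insert.IH a])
      then show "l \<in> span (insert b B)" by (auto simp: span_breakdown_eq)
    qed
  qed
qed

lemma linear_bounded_on_finite_span:
  fixes f :: "'v::real_normed_vector \<Rightarrow> 'w::real_normed_vector"
  assumes "finite B" and f: "linear f"
  shows "\<exists>C\<ge>0. \<forall>v\<in>span B. norm (f v) \<le> C * norm v"
  using assms(1)
proof (induction B rule: finite_induct)
  case empty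
  show ?case using f by (auto simp: linear_0 intro!: exI[of _ 0])
next
  case (insert b B)
  then obtain C where C: "C \<ge> 0" "\<And>v. v \<in> span B \<Longrightarrow> norm (f v) \<le> C * norm v" by blast
  show ?case
  proof (cases "b \<in> span B")
    case True
    then show ?thesis using C by (auto simp: span_redundant)
  next
    case False
    obtain \<delta> where d: "\<delta> > 0"
      "\<And>a y. y \<in> span B \<Longrightarrow> \<delta> * \<bar>a\<bar> \<le> norm (a *\<^sub>R b + y)"
      using coefficient_le_norm[OF closed_span_finite[OF insert.hyps(1)] subspace_span False] by blast
    define K where "K = norm (f b) / \<delta> + C * (1 + norm b / \<delta>)"
    have "norm (f v) \<le> K * norm v" if v: "v \<in> span (insert b B)" for v
    proof -
      obtain a where a: "v - a *\<^sub>R b \<in> span B" using v by (auto simp: span_breakdown_eq)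
      have "\<delta> * \<bar>a\<bar> \<le> norm v" using d(2)[OF a, of a] by simp
      then have abs: "\<bar>a\<bar> \<le> norm v / \<delta>" using d by (simp add: field_simps)
      have "norm (v - a *\<^sub>R b) \<le> norm v + \<bar>a\<bar> * norm b"
        using norm_triangle_ineq4[of v "a *\<^sub>R b"] by simp
      also have "\<dots> \<le> norm v + norm v / \<delta> * norm b"
        using mult_right_mono[OF abs norm_ge_zero[of b]] by simp
      finally have 1: "norm (v - a *\<^sub>R b) \<le> norm v + norm v / \<delta> * norm b" .
      have "f v = a *\<^sub>R f b + f (v - a *\<^sub>R b)"
        by (simp add: linear_diff[OF f] linear_scale[OF f])
      then have "norm (f v) \<le> \<bar>a\<bar> * norm (f b) + norm (f (v - a *\<^sub>R b))"
        by (metis norm_scaleR norm_triangle_ineq)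
      also have "\<dots> \<le> norm v / \<delta> * norm (f b) + C * (norm v + norm v / \<delta> * norm b)"
        using abs C(2)[OF a] mult_left_mono[OF 1 C(1)] by (intro add_mono mult_right_mono) auto
      also have "\<dots> = K * norm v" by (simp add: K_def algebra_simps)
      finally show ?thesis .
    qed
    moreover have "K \<ge> 0" using C d by (simp add: K_def)
    ultimately show ?thesis by blast
  qed
qed

section \<open>Frobenius' theorem on finite-dimensional real division algebras\<close>

text \<open>Bijectivity makes \<open>\<psi> 1\<close> the unit of \<open>D\<close>, which may differ from a unit of the ambient algebra.\<close>

definition algebra_iso :: "('d::real_algebra_1 \<Rightarrow> 'r::real_algebra) \<Rightarrow> 'r set \<Rightarrow> bool" where
  "algebra_iso \<psi> D \<longleftrightarrow> bij_betw \<psi> UNIV D \<and> (\<forall>p q. \<psi> (p + q) = \<psi> p + \<psi> q) \<and>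
     (\<forall>c p. \<psi> (c *\<^sub>R p) = c *\<^sub>R \<psi> p) \<and> (\<forall>p q. \<psi> (p * q) = \<psi> p * \<psi> q)"

abbreviation complex_poly :: "real poly \<Rightarrow> complex poly" where
  "complex_poly \<equiv> map_poly complex_of_real"

lemma poly_complex_poly_add:
  "poly (complex_poly (p + q)) z = poly (complex_poly p) z + poly (complex_poly q) z"
  by (induction p q rule: poly_induct2) (simp_all add: map_poly_pCons algebra_simps)

lemma poly_complex_poly_smult:
  "poly (complex_poly (Polynomial.smult c p)) z = complex_of_real c * poly (complex_poly p) z"
  by (induction p) (simp_all add: map_poly_pCons algebra_simps)

lemma poly_complex_poly_mult:
  "poly (complex_poly (p * q)) z = poly (complex_poly p) z * poly (complex_poly q) z"
  by (induction p)
    (simp_all add: map_poly_pCons poly_complex_poly_add poly_complex_poly_smult algebra_simps)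

lemma poly_complex_poly_of_real:
  "poly (complex_poly p) (complex_of_real x) = complex_of_real (poly p x)"
  by (induction p) (simp_all add: map_poly_pCons)

text \<open>The commutant will be a set of linear maps that vanish on a complement of \<open>V\<close>, and so its unit is a
  projection. This is why \<open>D\<close> is a subset of an ambient algebra with a unit \<open>e\<close> of its own.\<close>

locale finite_dimensional_domain =
  fixes D :: "'r::real_algebra set" and e :: 'r
  assumes subspace_D: "subspace D"
    and mult_closed: "a \<in> D \<Longrightarrow> b \<in> D \<Longrightarrow> a * b \<in> D"
    and unit_in: "e \<in> D" and unit_nonzero: "e \<noteq> 0"
    and unit_left [simp]: "a \<in> D \<Longrightarrow> e * a = a"
    and unit_right [simp]: "a \<in> D \<Longrightarrow> a * e = a"
    and no_zero_divisors: "a \<in> D \<Longrightarrow> b \<in> D \<Longrightarrow> a * b = 0 \<Longrightarrow> a = 0 \<or> b = 0"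
    and finite_dim: "finite_dimensional D"
begin

lemmas D_closed = subspace_0[OF subspace_D] subspace_add[OF subspace_D] subspace_diff[OF subspace_D]
  subspace_neg[OF subspace_D] subspace_mul[OF subspace_D] mult_closed unit_in

lemma unit_mult_unit [simp]: "e * e = e"
  using unit_in by simp

text \<open>The value \<open>p(a)\<close> of a real polynomial, with \<open>a\<^sup>0 = e\<close>.\<close>

definition peval :: "'r \<Rightarrow> real poly \<Rightarrow> 'r" where
  "peval a p = fold_coeffs (\<lambda>c r. c *\<^sub>R e + a * r) p 0"

lemma peval_0 [simp]: "peval a 0 = 0"
  by (simp add: peval_def)

lemma peval_pCons [simp]: "peval a (pCons c p) = c *\<^sub>R e + a * peval a p"
  by (cases "c = 0 \<and> p = 0") (auto simp: peval_def)

lemma peval_add: "peval a (p + q) = peval a p + peval a q"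
  by (induction p q rule: poly_induct2) (simp_all add: algebra_simps)

lemma peval_smult: "peval a (Polynomial.smult c p) = c *\<^sub>R peval a p"
  by (induction p) (simp_all add: algebra_simps)

lemma peval_in: "a \<in> D \<Longrightarrow> peval a p \<in> D"
  by (induction p) (simp_all add: D_closed)

lemma peval_mult: "a \<in> D \<Longrightarrow> peval a (p * q) = peval a p * peval a q"
  by (induction p)
    (simp_all add: peval_add peval_smult peval_in algebra_simps)

lemma peval_sum: "peval a (\<Sum>i\<in>I. f i) = (\<Sum>i\<in>I. peval a (f i))"
  by (induction I rule: infinite_finite_induct) (simp_all add: peval_add)

lemma algebraic:
  assumes a: "a \<in> D"
  shows "\<exists>p. p \<noteq> 0 \<and> peval a p = 0"
proof -
  obtain B where B: "finite B" "D \<subseteq> span B" using finite_dim by (auto simp: finite_dimensional_def)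
  obtain t where t: "\<exists>i\<in>{..card B}. t i \<noteq> 0"
      "(\<Sum>i\<in>{..card B}. t i *\<^sub>R peval a (monom 1 i)) = 0"
    using dependent_relation_in_finite_span[of B "{..card B}" "\<lambda>i. peval a (monom 1 i)"]
      B peval_in[OF a] by auto
  define p where "p = (\<Sum>i\<in>{..card B}. monom (t i) i)"
  have "peval a p = (\<Sum>i\<in>{..card B}. peval a (Polynomial.smult (t i) (monom 1 i)))"
    by (simp add: p_def peval_sum smult_monom)
  also have "\<dots> = 0" using t by (simp add: peval_smult)
  finally have "peval a p = 0" .
  moreover obtain i where "i \<le> card B" "t i \<noteq> 0" using t by auto
  then have "coeff p i \<noteq> 0" by (simp add: p_def coeff_sum)
  then have "p \<noteq> 0" by auto
  ultimately show ?thesis by blast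
qed

text \<open>Let \<open>P\<close> be a nonzero polynomial of minimal degree with \<open>P(a) = 0\<close>. As there are no zero divisors, each
  nonconstant divisor of \<open>P\<close> also vanishes at \<open>a\<close>. A complex root \<open>z\<close> of \<open>P\<close> gives a real divisor of degree one or two,
  namely \<open>X - z\<close> or \<open>(X - z) (X - cnj z)\<close>.\<close>

lemma quadratic:
  assumes a: "a \<in> D"
  shows "\<exists>p q. a * a = p *\<^sub>R a + q *\<^sub>R e"
proof -
  obtain P where P: "P \<noteq> 0" "peval a P = 0"
      and least: "\<And>Q. Q \<noteq> 0 \<Longrightarrow> peval a Q = 0 \<Longrightarrow> degree P \<le> degree Q"
    using ex_has_least_nat[of "\<lambda>Q. Q \<noteq> 0 \<and> peval a Q = 0" _ degree] algebraic[OF a] by blast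
  have divisor: "peval a Q = 0" if Q: "Q dvd P" "degree Q > 0" for Q
  proof -
    obtain S where S: "P = Q * S" using Q(1) by (rule dvdE)
    then have "S \<noteq> 0" "degree S < degree P" using P Q by (auto simp: degree_mult_eq)
    then have "peval a S \<noteq> 0" using least leD by blast
    then show ?thesis
      using no_zero_divisors[of "peval a Q" "peval a S"] P(2) S a by (auto simp: peval_mult peval_in)
  qed
  have "degree P \<noteq> 0"
  proof
    assume "degree P = 0"
    then obtain c where "P = [:c:]" by (rule degree_eq_zeroE)
    then show False using P unit_nonzero by simp
  qed
  then have "\<not> constant (poly (complex_poly P))"
    by (simp add: constant_degree degree_map_poly)
  then obtain z where z: "poly (complex_poly P) z = 0"
    using Fundamental_Theorem_Algebra.fundamental_theorem_of_algebra by blast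
  show ?thesis
  proof (cases "Im z = 0")
    case True
    then have "z = complex_of_real (Re z)" by (simp add: complex_eq_iff)
    then have "complex_of_real (poly P (Re z)) = 0"
      using z poly_complex_poly_of_real[of P "Re z"] by simp
    then have "poly P (Re z) = 0" by simp
    then have "[:- Re z, 1:] dvd P" by (simp add: poly_eq_0_iff_dvd)
    then have "a = Re z *\<^sub>R e" using divisor[of "[:- Re z, 1:]"] a by simp
    then have "a * a = Re z *\<^sub>R a + 0 *\<^sub>R e" using unit_in by simp
    then show ?thesis by blast
  next
    case False
    define Q where "Q = [:(Re z)\<^sup>2 + (Im z)\<^sup>2, - 2 * Re z, 1:]"
    have Qz: "poly (complex_poly Q) z = 0"
      by (simp add: Q_def map_poly_pCons complex_eq_iff power2_eq_square algebra_simps)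
    define r where "r = P mod Q"
    \<comment> \<open>The remainder has real coefficients and degree at most one, and vanishes at the nonreal \<open>z\<close>.\<close>
    have "degree r < 2 \<or> r = 0"
      using degree_mod_less[of Q P] by (auto simp: r_def Q_def)
    then have "degree r \<le> 1" by auto
    obtain r0 s where s: "r = pCons r0 s" by (cases r)
    then have "degree s = 0" using \<open>degree r \<le> 1\<close> by (auto simp: degree_pCons_eq_if split: if_splits)
    then obtain r1 where r: "r = [:r0, r1:]" using s by (auto elim: degree_eq_zeroE)
    have "P = Q * (P div Q) + r" by (simp add: r_def)
    then have "poly (complex_poly r) z = 0"
      using z Qz poly_complex_poly_add[of "Q * (P div Q)" r z] poly_complex_poly_mult[of Q "P div Q" z]
      by simp
    then have "complex_of_real r0 + z * complex_of_real r1 = 0" by (simp add: r map_poly_pCons)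
    then have "r1 = 0" "r0 = 0" using False by (auto simp: complex_eq_iff)
    then have "Q dvd P" using r r_def by (simp add: mod_eq_0_iff_dvd)
    moreover have "degree Q > 0" by (simp add: Q_def)
    ultimately have "peval a Q = 0" by (rule divisor)
    then have "a * a = (2 * Re z) *\<^sub>R a + (- ((Re z)\<^sup>2 + (Im z)\<^sup>2)) *\<^sub>R e"
      using a by (simp add: Q_def algebra_simps)
    then show ?thesis by blast
  qed
qed

text \<open>If \<open>b\<^sup>2 = p b + q e\<close> with \<open>q \<noteq> 0\<close>, then \<open>(b - p e) / q\<close> is an inverse; if \<open>q = 0\<close>, then \<open>b = p e\<close>.\<close>

lemma left_inverse:
  assumes b: "b \<in> D" "b \<noteq> 0"
  shows "\<exists>g\<in>D. g * b = e"
proof -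
  obtain p q where pq: "b * b = p *\<^sub>R b + q *\<^sub>R e" using quadratic b by blast
  define c where "c = b - p *\<^sub>R e"
  have c: "c * b = q *\<^sub>R e" "c \<in> D" using pq b by (simp_all add: c_def algebra_simps D_closed)
  show ?thesis
  proof (cases "q = 0")
    case True
    then have "b = p *\<^sub>R e" using no_zero_divisors[of c b] c b by (simp add: c_def)
    moreover from this have "p \<noteq> 0" using b(2) by auto
    ultimately have "((1 / p) *\<^sub>R e) * b = e" using unit_in by simp
    then show ?thesis by (intro bexI[of _ "(1 / p) *\<^sub>R e"]) (simp_all add: D_closed)
  next
    case False
    then have "((1 / q) *\<^sub>R c) * b = e" using c by simp
    then show ?thesis using c(2) by (intro bexI[of _ "(1 / q) *\<^sub>R c"]) (simp_all add: D_closed)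
  qed
qed

definition imaginary_unit :: "'r \<Rightarrow> bool" where
  "imaginary_unit i \<longleftrightarrow> i \<in> D \<and> i * i = - e"

text \<open>If \<open>c = s\<^sup>2\<close>, factor \<open>b\<^sup>2 - s\<^sup>2 e\<close>; otherwise rescale \<open>b\<close>.\<close>

lemma square_scalar_cases:
  assumes b: "b \<in> D" "b * b = c *\<^sub>R e"
  shows "(\<exists>s. b = s *\<^sub>R e) \<or> (\<exists>s i. imaginary_unit i \<and> b = s *\<^sub>R i)"
proof (cases "c \<ge> 0")
  case True
  have "(b - sqrt c *\<^sub>R e) * (b + sqrt c *\<^sub>R e) = 0"
    using b True by (simp add: algebra_simps)
  then have "b - sqrt c *\<^sub>R e = 0 \<or> b + sqrt c *\<^sub>R e = 0"
    using b by (intro no_zero_divisors) (simp_all add: D_closed)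
  then have "b = sqrt c *\<^sub>R e \<or> b = (- sqrt c) *\<^sub>R e"
    by (auto simp: add_eq_0_iff2)
  then show ?thesis by blast
next
  case False
  define s where "s = sqrt (- c)"
  have s: "s \<noteq> 0" "s * s = - c" using False by (simp_all add: s_def)
  have "((1 / s) *\<^sub>R b) * ((1 / s) *\<^sub>R b) = (1 / (s * s)) *\<^sub>R (b * b)" by simp
  also have "\<dots> = - e" using s False by (simp add: b)
  finally have "imaginary_unit ((1 / s) *\<^sub>R b)" using b by (simp add: imaginary_unit_def D_closed)
  moreover have "b = s *\<^sub>R ((1 / s) *\<^sub>R b)" using s by simp
  ultimately show ?thesis by blast
qed

text \<open>Completing the square in the quadratic equation of \<open>a\<close>.\<close>

lemma real_plus_imaginary:
  assumes a: "a \<in> D"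
  shows "(\<exists>s. a = s *\<^sub>R e) \<or> (\<exists>r s i. imaginary_unit i \<and> a = r *\<^sub>R e + s *\<^sub>R i)"
proof -
  obtain p q where pq: "a * a = p *\<^sub>R a + q *\<^sub>R e" using quadratic a by blast
  define b where "b = a - (p / 2) *\<^sub>R e"
  have b: "b \<in> D" using a by (simp add: b_def D_closed)
  have "b * b = a * a - p *\<^sub>R a + (p\<^sup>2 / 4) *\<^sub>R e"
    using a by (simp add: b_def algebra_simps power2_eq_square flip: scaleR_add_left)
  also have "\<dots> = (q + p\<^sup>2 / 4) *\<^sub>R e" by (simp add: pq algebra_simps)
  finally have "b * b = (q + p\<^sup>2 / 4) *\<^sub>R e" .
  moreover have "a = (p / 2) *\<^sub>R e + b" by (simp add: b_def)
  ultimately show ?thesis using square_scalar_cases[OF b]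
    by (metis scaleR_add_left)
qed

text \<open>Up to real multiples of \<open>e\<close> and scaling, \<open>d\<close> is an imaginary unit \<open>j\<close>. If \<open>j\<close> commutes with \<open>i\<close>, then
  \<open>(j - i) (j + i) = j\<^sup>2 - i\<^sup>2 = 0\<close>.\<close>

lemma centralizer_of_imaginary_unit:
  assumes i: "imaginary_unit i" and d: "d \<in> D" "d * i = i * d"
  shows "\<exists>r s. d = r *\<^sub>R e + s *\<^sub>R i"
  using real_plus_imaginary[OF d(1)]
proof
  assume "\<exists>s. d = s *\<^sub>R e"
  then show ?thesis by (metis add.right_neutral scaleR_zero_left)
next
  assume "\<exists>r s j. imaginary_unit j \<and> d = r *\<^sub>R e + s *\<^sub>R j"
  then obtain r s j where j: "imaginary_unit j" "d = r *\<^sub>R e + s *\<^sub>R j" by blast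
  have iD: "i \<in> D" "i * i = - e" "j \<in> D" "j * j = - e" using i j by (auto simp: imaginary_unit_def)
  show ?thesis
  proof (cases "s = 0")
    case True
    then show ?thesis using j by (metis scaleR_zero_left)
  next
    case False
    have "s *\<^sub>R (j * i) = s *\<^sub>R (i * j)" using d j iD by (simp add: algebra_simps)
    then have "j * i = i * j" using False by simp
    then have "(j - i) * (j + i) = 0" using iD by (simp add: algebra_simps)
    then have "j - i = 0 \<or> j + i = 0" using iD by (intro no_zero_divisors) (simp_all add: D_closed)
    then have "j = 1 *\<^sub>R i \<or> j = (- 1) *\<^sub>R i" by (auto simp: add_eq_0_iff2)
    then show ?thesis using j by (metis scaleR_scaleR)
  qed
qed

text \<open>The square of \<open>x\<close> commutes with \<open>i\<close>, hence is \<open>r e + s i\<close>; it also commutes with \<open>x\<close>, while \<open>i\<close>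
  does not, so \<open>s = 0\<close>. As \<open>x\<close> is not a scalar, it is a multiple of an imaginary unit.\<close>

lemma anticommuting_imaginary_unit:
  assumes i: "imaginary_unit i" and x: "x \<in> D" "x \<noteq> 0" "x * i = - (i * x)"
  shows "\<exists>j. imaginary_unit j \<and> j * i = - (i * j)"
proof -
  have iD: "i \<in> D" "i * i = - e" using i by (auto simp: imaginary_unit_def)
  have inz: "i \<noteq> 0" using iD unit_nonzero by auto
  have "x * x * i = x * (x * i)" by (simp add: mult.assoc)
  also have "\<dots> = - (x * i * x)" by (subst x(3)) (simp add: mult.assoc)
  also have "\<dots> = i * (x * x)" unfolding x(3) by (simp add: mult.assoc)
  finally have "(x * x) * i = i * (x * x)" .
  then obtain r s where rs: "x * x = r *\<^sub>R e + s *\<^sub>R i"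
    using centralizer_of_imaginary_unit[OF i mult_closed[OF x(1) x(1)]] by blast
  have "x * (x * x) = (x * x) * x" by (simp add: mult.assoc)
  then have "s *\<^sub>R (i * x) + s *\<^sub>R (i * x) = 0" using x by (simp add: rs algebra_simps)
  then have "(2 * s) *\<^sub>R (i * x) = 0" by (simp flip: scaleR_add_left)
  moreover have "i * x \<noteq> 0" using no_zero_divisors[of i x] iD inz x by blast
  ultimately have "s = 0" by simp
  then have "x * x = r *\<^sub>R e" using rs by simp
  with square_scalar_cases[OF x(1)]
  consider c where "x = c *\<^sub>R e" | c j where "imaginary_unit j" "x = c *\<^sub>R j" by blast
  then show ?thesis
  proof cases
    case 1
    then have "i * x = - (i * x)" using x(3) iD by simp
    then have "i * x = 0" by (metis add_eq_0_iff scaleR_2 scaleR_eq_0_iff zero_neq_numeral)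
    then show ?thesis using \<open>i * x \<noteq> 0\<close> by simp
  next
    case 2
    then have "c \<noteq> 0" using x by auto
    have "c *\<^sub>R (j * i) = c *\<^sub>R (- (i * j))" using x(3) 2 by simp
    then show ?thesis using 2 \<open>c \<noteq> 0\<close> by (metis scaleR_cancel_left)
  qed
qed

lemma real_iso:
  assumes "\<forall>d\<in>D. \<exists>r. d = r *\<^sub>R e"
  shows "algebra_iso (\<lambda>r::real. r *\<^sub>R e) D"
proof -
  have "bij_betw (\<lambda>r::real. r *\<^sub>R e) UNIV D"
    using assms unit_nonzero by (force simp: bij_betw_def inj_on_def D_closed)
  then show ?thesis by (simp add: algebra_iso_def algebra_simps)
qed

text \<open>Injectivity comes from \<open>cnj u * u = |u|\<^sup>2\<close>: the map is multiplicative, and \<open>|u|\<^sup>2 e\<close> vanishes only for \<open>u = 0\<close>.\<close>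

lemma complex_iso:
  assumes i: "imaginary_unit i" and "\<forall>d\<in>D. \<exists>r s. d = r *\<^sub>R e + s *\<^sub>R i"
  shows "algebra_iso (\<lambda>z. Re z *\<^sub>R e + Im z *\<^sub>R i) D"
proof -
  let ?f = "\<lambda>z. Re z *\<^sub>R e + Im z *\<^sub>R i"
  have iD: "i \<in> D" "i * i = - e" using i by (auto simp: imaginary_unit_def)
  have mult: "?f (z * w) = ?f z * ?f w" for z w
    using iD by (simp add: algebra_simps)
  have "z = w" if "?f z = ?f w" for z w
  proof -
    have "?f (z - w) = 0" using that by (simp add: algebra_simps)
    moreover have "?f (cnj u * u) = (cmod u)\<^sup>2 *\<^sub>R e" for u
      using cmod_power2[of u] by (simp add: power2_eq_square)
    from this[of "z - w"] have "?f (cnj (z - w)) * ?f (z - w) = (cmod (z - w))\<^sup>2 *\<^sub>R e"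
      unfolding mult .
    ultimately have "(cmod (z - w))\<^sup>2 *\<^sub>R e = 0" by simp
    then show ?thesis using unit_nonzero by simp
  qed
  then have "inj ?f" by (rule injI)
  moreover have "range ?f = D"
  proof
    show "D \<subseteq> range ?f"
    proof
      fix d assume "d \<in> D"
      then obtain r s where "d = r *\<^sub>R e + s *\<^sub>R i" using assms by blast
      then have "d = ?f (Complex r s)" by simp
      then show "d \<in> range ?f" by blast
    qed
  qed (use iD in \<open>auto simp: D_closed\<close>)
  ultimately show ?thesis using mult by (simp add: algebra_iso_def bij_betw_def algebra_simps)
qed

lemma quaternion_iso:
  assumes i: "imaginary_unit i" and j: "imaginary_unit j" and ij: "j * i = - (i * j)"
    and "\<forall>d\<in>D. \<exists>r s t u. d = r *\<^sub>R e + s *\<^sub>R i + t *\<^sub>R j + u *\<^sub>R (i * j)"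
  shows "algebra_iso (\<lambda>z. q_re z *\<^sub>R e + q_i z *\<^sub>R i + q_j z *\<^sub>R j + q_k z *\<^sub>R (i * j)) D"
proof -
  let ?f = "\<lambda>z. q_re z *\<^sub>R e + q_i z *\<^sub>R i + q_j z *\<^sub>R j + q_k z *\<^sub>R (i * j)"
  have iD: "i \<in> D" "i * i = - e" "j \<in> D" "j * j = - e" using i j by (auto simp: imaginary_unit_def)
  define k where "k = i * j"
  have kD: "k \<in> D" using iD D_closed by (simp add: k_def)
  have table: "i * j = k" "j * i = - k" "i * k = - j" "k * i = j" "j * k = i" "k * j = - i" "k * k = - e"
  proof -
    show "i * j = k" "j * i = - k" using ij by (simp_all add: k_def)
    show ik: "i * k = - j" unfolding k_def using iD by (simp flip: mult.assoc)
    show "k * j = - i" unfolding k_def using iD by (simp add: mult.assoc)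
    show "k * i = j" unfolding k_def using iD ij by (metis ik k_def minus_minus mult.assoc mult_minus_right)
    show "j * k = i" unfolding k_def using iD ij
      by (metis minus_minus mult.assoc mult_minus_left mult_minus_right unit_right)
    have "k * k = i * (j * k)" by (simp add: k_def mult.assoc)
    then show "k * k = - e" using \<open>j * k = i\<close> iD by simp
  qed
  have mult: "?f (z * w) = ?f z * ?f w" for z w
    using iD kD by (simp add: table times_quat_def algebra_simps)
  have add: "?f (z + w) = ?f z + ?f w" and scale: "?f (c *\<^sub>R z) = c *\<^sub>R ?f z" for c z w
    by (simp_all add: plus_quat_def scaleR_quat_def algebra_simps)
  have "z = w" if eq: "?f z = ?f w" for z w
  proof -
    define q where "q = z - w"
    have q: "?f q = 0" using eq add[of q w] by (simp add: q_def)
    \<comment> \<open>As for the complex field: \<open>n\<close> is the product of \<open>q\<close> with its conjugate.\<close>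
    define n where "n = (q_re q)\<^sup>2 + (q_i q)\<^sup>2 + (q_j q)\<^sup>2 + (q_k q)\<^sup>2"
    have "?f (Quat (q_re q) (- q_i q) (- q_j q) (- q_k q) * q) = n *\<^sub>R e"
      by (simp add: times_quat_def n_def power2_eq_square)
    then have "n *\<^sub>R e = 0" unfolding mult q by simp
    then have "n = 0" using unit_nonzero by simp
    then have "q = 0"
      by (cases q) (simp add: n_def zero_quat_def add_nonneg_eq_0_iff)
    then show ?thesis by (simp add: q_def)
  qed
  then have "inj ?f" by (rule injI)
  moreover have "range ?f = D"
  proof
    show "D \<subseteq> range ?f"
    proof
      fix d assume "d \<in> D"
      then obtain r s t u where "d = r *\<^sub>R e + s *\<^sub>R i + t *\<^sub>R j + u *\<^sub>R (i * j)" using assms by blast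
      then have "d = ?f (Quat r s t u)" by simp
      then show "d \<in> range ?f" by blast
    qed
  qed (use iD in \<open>auto simp: D_closed\<close>)
  ultimately show ?thesis using mult add scale by (simp add: algebra_iso_def bij_betw_def)
qed

text \<open>Fix an imaginary unit \<open>i\<close>. Each \<open>d\<close> is half the sum of \<open>d - i d i\<close>, which commutes with \<open>i\<close>, and \<open>d + i d i\<close>,
  which anticommutes with \<open>i\<close>. The former lies in the span of \<open>e\<close> and \<open>i\<close>. If the latter is always zero, \<open>D\<close> is the
  complex field. Otherwise there is an imaginary unit \<open>j\<close> that anticommutes with \<open>i\<close>, and right
  multiplication by \<open>j\<close> carries the anticommuting part into the commuting one, so that \<open>e, i, j, i j\<close> span \<open>D\<close>.\<close>

theorem frobenius:
  "(\<exists>\<psi>::real \<Rightarrow> 'r. algebra_iso \<psi> D) \<or> (\<exists>\<psi>::complex \<Rightarrow> 'r. algebra_iso \<psi> D) \<or>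
   (\<exists>\<psi>::quat \<Rightarrow> 'r. algebra_iso \<psi> D)"
proof (cases "\<forall>d\<in>D. \<exists>r. d = r *\<^sub>R e")
  case True
  then show ?thesis using real_iso by blast
next
  case False
  then obtain i where i: "imaginary_unit i" using real_plus_imaginary by blast
  then have iD: "i \<in> D" "i * i = - e" by (auto simp: imaginary_unit_def)
  then have iid: "i * (i * d) = - d" and dii: "d * i * i = - d" if "d \<in> D" for d
    using that by (simp_all flip: mult.assoc) (simp add: mult.assoc)
  have plus: "\<exists>r s. d - i * d * i = r *\<^sub>R e + s *\<^sub>R i" if "d \<in> D" for d
    using that iD by (intro centralizer_of_imaginary_unit[OF i])
      (simp_all add: D_closed algebra_simps iid dii)
  show ?thesis
  proof (cases "\<forall>d\<in>D. d + i * d * i = 0")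
    case True
    have "\<exists>r s. d = r *\<^sub>R e + s *\<^sub>R i" if d: "d \<in> D" for d
    proof -
      obtain r s where "d - i * d * i = r *\<^sub>R e + s *\<^sub>R i" using plus d by blast
      moreover have "i * d * i = - d" using True d by (simp add: add_eq_0_iff)
      ultimately have "2 *\<^sub>R d = r *\<^sub>R e + s *\<^sub>R i" by (simp add: scaleR_2)
      then have "d = (1 / 2) *\<^sub>R (r *\<^sub>R e + s *\<^sub>R i)" by (metis scaleR_half_double scaleR_2)
      then have "d = (r / 2) *\<^sub>R e + (s / 2) *\<^sub>R i" by (simp add: algebra_simps)
      then show ?thesis by blast
    qed
    then show ?thesis using complex_iso[OF i] by blast
  next
    case False
    have anti: "(d + i * d * i) * i = - (i * (d + i * d * i))" if "d \<in> D" for d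
      using that iD by (simp add: algebra_simps iid dii D_closed)
    obtain d where "d \<in> D" "d + i * d * i \<noteq> 0" using False by blast
    then obtain x where x: "x \<in> D" "x \<noteq> 0" "x * i = - (i * x)"
      using anti[of d] iD by (intro that[of "d + i * d * i"]) (simp_all add: D_closed)
    obtain j where j: "imaginary_unit j" and ji: "j * i = - (i * j)"
      using anticommuting_imaginary_unit[OF i x] by blast
    then have jD: "j \<in> D" "j * j = - e" by (auto simp: imaginary_unit_def)
    have "\<exists>r s t u. d = r *\<^sub>R e + s *\<^sub>R i + t *\<^sub>R j + u *\<^sub>R (i * j)" if d: "d \<in> D" for d
    proof -
      obtain r s where rs: "d - i * d * i = r *\<^sub>R e + s *\<^sub>R i" using plus d by blast
      define m where "m = d + i * d * i"
      have m: "m \<in> D" "m * i = - (i * m)" using d iD anti by (simp_all add: m_def D_closed)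
      have "(m * j) * i = i * (m * j)"
        using m ji by (metis minus_minus mult.assoc mult_minus_left mult_minus_right)
      then obtain t u where tu: "m * j = t *\<^sub>R e + u *\<^sub>R i"
        using centralizer_of_imaginary_unit[OF i mult_closed[OF m(1) jD(1)]] by blast
      have "m = - (m * j * j)" using m jD by (simp add: mult.assoc)
      also have "\<dots> = - t *\<^sub>R j - u *\<^sub>R (i * j)" using jD by (simp add: tu algebra_simps)
      finally have m2: "m = - t *\<^sub>R j - u *\<^sub>R (i * j)" .
      have "2 *\<^sub>R d = (d - i * d * i) + m" by (simp add: m_def scaleR_2)
      then have "d = (1 / 2) *\<^sub>R ((d - i * d * i) + m)" by (metis scaleR_half_double scaleR_2)
      then have "d = (r / 2) *\<^sub>R e + (s / 2) *\<^sub>R i + (- t / 2) *\<^sub>R j + (- u / 2) *\<^sub>R (i * j)"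
        unfolding rs m2 by (simp add: algebra_simps)
      then show ?thesis by blast
    qed
    then show ?thesis using quaternion_iso[OF i j ji] by blast
  qed
qed

end

section \<open>The algebra of linear endomorphisms\<close>

text \<open>The operators in the commutant may be unbounded, so they do not live in the type of bounded
  operators; this type gives them a common ambient algebra. It is not unital by class, since
  the zero space has \<open>0 = 1\<close>.\<close>

typedef (overloaded) 'a endo = "{f :: 'a::real_vector \<Rightarrow> 'a. linear f}"
  morphisms endo_apply Endo
  by (rule exI[of _ id]) (simp add: linear_id)

lemma linear_endo_apply: "linear (endo_apply f)"
  using endo_apply by blast

lemmas endo_apply_simps [simp] =
  linear_0[OF linear_endo_apply] linear_add[OF linear_endo_apply]
  linear_diff[OF linear_endo_apply] linear_scale[OF linear_endo_apply]

lemma endo_apply_Endo: "linear f \<Longrightarrow> endo_apply (Endo f) = f"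
  by (simp add: Endo_inverse)

lemma endo_eqI: "(\<And>x. endo_apply f x = endo_apply g x) \<Longrightarrow> f = g"
  using endo_apply_inject by blast

instantiation endo :: (real_vector) real_algebra
begin

definition "0 = Endo (\<lambda>_. 0)"
definition "f + g = Endo (\<lambda>x. endo_apply f x + endo_apply g x)"
definition "f - g = Endo (\<lambda>x. endo_apply f x - endo_apply g x)"
definition "- f = Endo (\<lambda>x. - endo_apply f x)"
definition "c *\<^sub>R f = Endo (\<lambda>x. c *\<^sub>R endo_apply f x)"
definition "f * g = Endo (\<lambda>x. endo_apply f (endo_apply g x))"

lemma endo_apply_ops [simp]:
  "endo_apply 0 x = 0"
  "endo_apply (f + g) x = endo_apply f x + endo_apply g x"
  "endo_apply (f - g) x = endo_apply f x - endo_apply g x"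
  "endo_apply (- f) x = - endo_apply f x"
  "endo_apply (c *\<^sub>R f) x = c *\<^sub>R endo_apply f x"
  "endo_apply (f * g) x = endo_apply f (endo_apply g x)"
  unfolding zero_endo_def plus_endo_def minus_endo_def uminus_endo_def scaleR_endo_def times_endo_def
  by (subst endo_apply_Endo; auto intro!: linearI simp: algebra_simps)+

instance
  by standard (auto intro!: endo_eqI simp: algebra_simps)

end

lemma endo_apply_sum: "endo_apply (\<Sum>i\<in>I. f i) x = (\<Sum>i\<in>I. endo_apply (f i) x)"
  by (induction I rule: infinite_finite_induct) auto

section \<open>Finite rank operators of an L-algebra\<close>

lemma linear_blinfun: "linear (blinfun_apply T)"
  by (intro bounded_linear.linear blinfun.bounded_linear_right)

lemma finite_rank_add:
  assumes "finite_rank S" "finite_rank T"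
  shows "finite_rank (S + T)"
proof -
  obtain B C where "finite B" "range (blinfun_apply S) \<subseteq> span B"
      "finite C" "range (blinfun_apply T) \<subseteq> span C"
    using assms by (auto simp: finite_rank_def finite_dimensional_def)
  then have "range (blinfun_apply (S + T)) \<subseteq> span (B \<union> C)" "finite (B \<union> C)"
    using span_mono[of B "B \<union> C"] span_mono[of C "B \<union> C"]
    by (auto simp: blinfun.add_left intro!: span_add)
  then show ?thesis unfolding finite_rank_def finite_dimensional_def by blast
qed

lemma finite_rank_scaleR:
  assumes "finite_rank T"
  shows "finite_rank (c *\<^sub>R T)"
proof -
  obtain B where "finite B" "range (blinfun_apply T) \<subseteq> span B"
    using assms by (auto simp: finite_rank_def finite_dimensional_def)
  then have "range (blinfun_apply (c *\<^sub>R T)) \<subseteq> span B"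
    by (auto simp: blinfun.scaleR_left intro!: span_scale)
  then show ?thesis using \<open>finite B\<close> unfolding finite_rank_def finite_dimensional_def by blast
qed

lemma finite_rank_compose_left:
  assumes "finite_rank S"
  shows "finite_rank (S o\<^sub>L T)"
  using assms unfolding finite_rank_def finite_dimensional_def by fastforce

lemma finite_rank_compose_right:
  assumes "finite_rank T"
  shows "finite_rank (S o\<^sub>L T)"
proof -
  obtain B where "finite B" "range (blinfun_apply T) \<subseteq> span B"
    using assms by (auto simp: finite_rank_def finite_dimensional_def)
  then have "range (blinfun_apply (S o\<^sub>L T)) \<subseteq> span (blinfun_apply S ` B)"
    by (auto simp: linear_span_image[OF linear_blinfun])
  then show ?thesis using \<open>finite B\<close> unfolding finite_rank_def finite_dimensional_def by blast
qed

lemma finite_dimensional_subspace: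
  assumes "subspace E" "E \<subseteq> span B" "finite B"
  shows "\<exists>C. finite C \<and> E = span C"
proof -
  obtain C where C: "C \<subseteq> E" "independent C" "E \<subseteq> span C"
    using maximal_independent_subset by metis
  then have "finite C" using independent_span_bound[of B C] assms by blast
  moreover have "E = span C" using C assms(1) by (simp add: span_minimal subset_antisym)
  ultimately show ?thesis by blast
qed

locale L_algebra_locale =
  fixes A :: "('a::real_normed_vector \<Rightarrow>\<^sub>L 'a) set"
  assumes L: "L_algebra A"
begin

abbreviation "F \<equiv> finite_rank_part A"
abbreviation "V \<equiv> finite_rank_space A"

lemma subspace_A: "subspace A" and compose_A: "S \<in> A \<Longrightarrow> T \<in> A \<Longrightarrow> S o\<^sub>L T \<in> A"
  and transitive: "\<epsilon> > 0 \<Longrightarrow> x \<noteq> 0 \<Longrightarrow> \<exists>T\<in>A. norm (blinfun_apply T x - y) < \<epsilon>"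
  and nonzero_in_F: "\<exists>T\<in>F. T \<noteq> 0"
proof -
  from L have *: "subspace A" "\<forall>S\<in>A. \<forall>T\<in>A. S o\<^sub>L T \<in> A"
    "\<forall>\<epsilon>>0. \<forall>x y. x \<noteq> 0 \<longrightarrow> (\<exists>T\<in>A. norm (blinfun_apply T x - y) < \<epsilon>)"
    "\<exists>T\<in>A. T \<noteq> 0 \<and> finite_rank T"
    by (simp_all add: L_algebra_def transitive_algebra_def operator_algebra_def)
  then show "subspace A" "S \<in> A \<Longrightarrow> T \<in> A \<Longrightarrow> S o\<^sub>L T \<in> A" by simp_all
  show "\<epsilon> > 0 \<Longrightarrow> x \<noteq> 0 \<Longrightarrow> \<exists>T\<in>A. norm (blinfun_apply T x - y) < \<epsilon>" using *(3) by simp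
  show "\<exists>T\<in>F. T \<noteq> 0" using *(4) by (auto simp: finite_rank_part_def)
qed

lemma F_in_A: "T \<in> F \<Longrightarrow> T \<in> A" and F_finite_rank: "T \<in> F \<Longrightarrow> finite_rank T"
  by (simp_all add: finite_rank_part_def)

lemma subspace_F: "subspace F"
proof (rule subspaceI)
  have "finite_rank (0 :: 'a \<Rightarrow>\<^sub>L 'a)"
    unfolding finite_rank_def finite_dimensional_def by (intro exI[of _ "{}"]) auto
  then show "0 \<in> F" by (simp add: finite_rank_part_def subspace_0[OF subspace_A])
qed (simp_all add: finite_rank_part_def finite_rank_add finite_rank_scaleR
    subspace_add[OF subspace_A] subspace_mul[OF subspace_A])

lemma compose_F_left: "S \<in> F \<Longrightarrow> T \<in> A \<Longrightarrow> S o\<^sub>L T \<in> F"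
  and compose_F_right: "S \<in> A \<Longrightarrow> T \<in> F \<Longrightarrow> S o\<^sub>L T \<in> F"
  by (simp_all add: finite_rank_part_def compose_A finite_rank_compose_left finite_rank_compose_right)

lemma subspace_V: "subspace V"
  by (simp add: finite_rank_space_def)

lemmas V_closed = subspace_0[OF subspace_V] subspace_add[OF subspace_V] subspace_diff[OF subspace_V]
  subspace_neg[OF subspace_V] subspace_mul[OF subspace_V]

lemma range_in_V: "T \<in> F \<Longrightarrow> blinfun_apply T x \<in> V"
  unfolding finite_rank_space_def by (intro span_base) blast

lemma V_minimal:
  assumes "subspace W" "\<And>T x. T \<in> F \<Longrightarrow> blinfun_apply T x \<in> W"
  shows "V \<subseteq> W"
  unfolding finite_rank_space_def using assms by (intro span_minimal) auto

lemma A_invariant_V: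
  assumes "S \<in> A" "v \<in> V"
  shows "blinfun_apply S v \<in> V"
proof -
  have "V \<subseteq> {v. blinfun_apply S v \<in> V}"
  proof (rule V_minimal)
    show "subspace {v. blinfun_apply S v \<in> V}"
      by (auto intro!: subspaceI simp: blinfun.add_right blinfun.scaleR_right V_closed)
    show "blinfun_apply T x \<in> {v. blinfun_apply S v \<in> V}" if "T \<in> F" for T x
      using range_in_V[OF compose_F_right[OF assms(1) that], of x] by simp
  qed
  then show ?thesis using assms by blast
qed

text \<open>Transitivity moves \<open>x\<close> so close to a vector \<open>v\<close> with \<open>T v \<noteq> 0\<close> that \<open>T\<close> cannot kill the image.\<close>

lemma F_nonzero_at:
  assumes "x \<noteq> 0"
  shows "\<exists>T\<in>F. blinfun_apply T x \<noteq> 0"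
proof -
  obtain T where T: "T \<in> F" "T \<noteq> 0" using nonzero_in_F by blast
  then obtain v where v: "blinfun_apply T v \<noteq> 0"
    by (metis blinfun_eqI zero_blinfun.rep_eq)
  define \<epsilon> where "\<epsilon> = norm (blinfun_apply T v) / (norm T + 1)"
  have pos: "norm T + 1 > 0" by (simp add: add_nonneg_pos)
  have "\<epsilon> > 0" using v pos by (simp add: \<epsilon>_def)
  then obtain S where S: "S \<in> A" "norm (blinfun_apply S x - v) < \<epsilon>" using transitive assms by blast
  have "blinfun_apply T (blinfun_apply S x) \<noteq> 0"
  proof
    assume "blinfun_apply T (blinfun_apply S x) = 0"
    then have "norm (blinfun_apply T v) = norm (blinfun_apply T (blinfun_apply S x - v))"
      by (simp add: blinfun.diff_right)
    also have "\<dots> \<le> norm T * norm (blinfun_apply S x - v)" by (rule norm_blinfun)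
    also have "\<dots> \<le> (norm T + 1) * norm (blinfun_apply S x - v)" by (simp add: mult_right_mono)
    also have "\<dots> < (norm T + 1) * \<epsilon>" using S pos by (intro mult_strict_left_mono)
    also have "\<dots> = norm (blinfun_apply T v)" using pos by (simp add: \<epsilon>_def)
    finally show False by simp
  qed
  then show ?thesis using compose_F_left[OF T(1) S(1)] by force
qed

text \<open>For \<open>T \<in> F\<close> the space \<open>T (F x)\<close> is dense in the range of \<open>T\<close>, because \<open>A (R x)\<close> is dense for some \<open>R \<in> F\<close>; it is
  finite-dimensional, hence closed, hence all of the range of \<open>T\<close>. And \<open>T (F x) \<subseteq> F x\<close>. That \<open>x\<close>
  need not lie in \<open>V\<close> is essential below, since density concerns families in the whole space.\<close>

lemma F_orbit:
  assumes x: "x \<noteq> 0" and v: "v \<in> V"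
  shows "\<exists>T\<in>F. blinfun_apply T x = v"
proof -
  define Orb where "Orb = (\<lambda>S. blinfun_apply S x) ` F"
  have sub: "subspace ((\<lambda>S. f (blinfun_apply S x)) ` F)" if "linear f" for f :: "'a \<Rightarrow> 'a"
    using that
    by (intro linear_subspace_image[OF _ subspace_F] linearI)
      (auto simp: blinfun.add_left blinfun.scaleR_left linear_add linear_scale)
  have "V \<subseteq> Orb"
  proof (rule V_minimal)
    show "subspace Orb" using sub[OF linear_id] by (simp add: Orb_def)
    fix T y assume T: "T \<in> F"
    define E where "E = (\<lambda>S. blinfun_apply T (blinfun_apply S x)) ` F"
    obtain B where B: "finite B" "range (blinfun_apply T) \<subseteq> span B"
      using F_finite_rank[OF T] by (auto simp: finite_rank_def finite_dimensional_def)
    have "subspace E" unfolding E_def by (rule sub[OF linear_blinfun])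
    moreover have "E \<subseteq> span B" using B by (auto simp: E_def)
    ultimately have "closed E" using finite_dimensional_subspace B closed_span_finite by metis
    obtain R where R: "R \<in> F" "blinfun_apply R x \<noteq> 0" using F_nonzero_at x by blast
    have "blinfun_apply T y \<in> closure E"
      unfolding closure_approachable
    proof (intro allI impI)
      fix \<epsilon> :: real assume "\<epsilon> > 0"
      have pos: "norm T + 1 > 0" by (simp add: add_nonneg_pos)
      then obtain S where S: "S \<in> A" "norm (blinfun_apply S (blinfun_apply R x) - y) < \<epsilon> / (norm T + 1)"
        using transitive[of "\<epsilon> / (norm T + 1)" "blinfun_apply R x" y] R \<open>\<epsilon> > 0\<close> by auto
      let ?z = "blinfun_apply T (blinfun_apply S (blinfun_apply R x))"
      have "dist ?z (blinfun_apply T y) = norm (blinfun_apply T (blinfun_apply S (blinfun_apply R x) - y))"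
        by (simp add: dist_norm blinfun.diff_right)
      also have "\<dots> \<le> norm T * norm (blinfun_apply S (blinfun_apply R x) - y)" by (rule norm_blinfun)
      also have "\<dots> \<le> (norm T + 1) * norm (blinfun_apply S (blinfun_apply R x) - y)"
        by (simp add: mult_right_mono)
      also have "\<dots> < \<epsilon>" using S pos by (simp add: pos_less_divide_eq mult.commute)
      finally have "dist ?z (blinfun_apply T y) < \<epsilon>" .
      moreover have "?z \<in> E"
        unfolding E_def using compose_F_right[OF S(1) R(1)] by (intro image_eqI[of _ _ "S o\<^sub>L R"]) auto
      ultimately show "\<exists>z\<in>E. dist z (blinfun_apply T y) < \<epsilon>" by blast
    qed
    then have "blinfun_apply T y \<in> E" using \<open>closed E\<close> by simp
    then obtain S where S: "S \<in> F" "blinfun_apply T y = blinfun_apply T (blinfun_apply S x)"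
      by (auto simp: E_def)
    show "blinfun_apply T y \<in> Orb"
      unfolding Orb_def using S compose_F_right[OF F_in_A[OF T] S(1)]
      by (intro image_eqI[of _ _ "T o\<^sub>L S"]) auto
  qed
  then show ?thesis using v by (force simp: Orb_def)
qed

lemma V_nonzero: "\<exists>u\<in>V. u \<noteq> 0"
proof -
  obtain T where T: "T \<in> F" "T \<noteq> 0" using nonzero_in_F by blast
  then obtain v where "blinfun_apply T v \<noteq> 0"
    by (metis blinfun_eqI zero_blinfun.rep_eq)
  then show ?thesis using range_in_V T by blast
qed

lemma V_dense: "\<epsilon> > 0 \<Longrightarrow> \<exists>v\<in>V. norm (y - v) < \<epsilon>"
  using V_nonzero transitive A_invariant_V by (metis norm_minus_commute)

section \<open>The commutant as a finite-dimensional domain\<close>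

text \<open>A linear projection onto \<open>V\<close>, in general discontinuous; it extends operators on \<open>V\<close> to the whole space.\<close>

definition proj :: "'a \<Rightarrow> 'a" where
  "proj = (SOME g. range g \<subseteq> V \<and> linear g \<and> (\<forall>v\<in>V. g v = v))"

lemma range_proj: "proj x \<in> V" and linear_proj: "linear proj" and proj_V [simp]: "v \<in> V \<Longrightarrow> proj v = v"
proof -
  have "\<exists>g. range g \<subseteq> V \<and> linear g \<and> (\<forall>v\<in>V. g v = v)"
    using linear_exists_left_inverse_on[OF linear_id subspace_V] by simp
  from someI_ex[OF this]
  have "range proj \<subseteq> V \<and> linear proj \<and> (\<forall>v\<in>V. proj v = v)" unfolding proj_def .
  then show "proj x \<in> V" "linear proj" "v \<in> V \<Longrightarrow> proj v = v" by auto
qed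

text \<open>The elements of \<^const>\<open>finite_rank_commutant\<close>, extended through \<^const>\<open>proj\<close> in order to become
  endomorphisms of the whole space.\<close>

definition commutant :: "'a endo set" where
  "commutant = {f. (\<forall>x. endo_apply f (proj x) = endo_apply f x) \<and> (\<forall>v\<in>V. endo_apply f v \<in> V) \<and>
     (\<forall>T\<in>F. \<forall>v\<in>V. endo_apply f (blinfun_apply T v) = blinfun_apply T (endo_apply f v))}"

lemma commutant_proj: "f \<in> commutant \<Longrightarrow> endo_apply f (proj x) = endo_apply f x"
  and commutant_V: "f \<in> commutant \<Longrightarrow> v \<in> V \<Longrightarrow> endo_apply f v \<in> V"
  and commutant_commutes: "f \<in> commutant \<Longrightarrow> T \<in> F \<Longrightarrow> v \<in> V \<Longrightarrow>
    endo_apply f (blinfun_apply T v) = blinfun_apply T (endo_apply f v)"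
  by (simp_all add: commutant_def)

lemma commutant_range: "f \<in> commutant \<Longrightarrow> endo_apply f x \<in> V"
  by (metis commutant_proj commutant_V range_proj)

text \<open>Schur: the kernel is \<open>F\<close>-invariant and \<open>F u = V\<close>.\<close>

lemma commutant_kernel:
  assumes f: "f \<in> commutant" and u: "u \<in> V" "u \<noteq> 0" "endo_apply f u = 0"
  shows "f = 0"
proof (rule endo_eqI)
  fix x
  obtain T where T: "T \<in> F" "blinfun_apply T u = proj x" using F_orbit[OF u(2) range_proj] by blast
  have "endo_apply f x = endo_apply f (blinfun_apply T u)" using commutant_proj[OF f] T by simp
  also have "\<dots> = 0" using commutant_commutes[OF f T(1) u(1)] u by (simp add: blinfun.zero_right)
  finally show "endo_apply f x = endo_apply 0 x" by simp
qed

lemma subspace_commutant: "subspace commutant"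
  by (auto intro!: subspaceI simp: commutant_def V_closed blinfun.add_right blinfun.scaleR_right
      blinfun.zero_right)

text \<open>Evaluation at \<open>S u\<close> is injective by \<open>commutant_kernel\<close>, and \<open>f (S u) = S (f u)\<close> lies in the
  finite-dimensional range of \<open>S\<close>.\<close>

lemma commutant_finite_dimensional: "finite_dimensional commutant"
proof -
  obtain u where u: "u \<in> V" "u \<noteq> 0" using V_nonzero by blast
  obtain S where S: "S \<in> F" "blinfun_apply S u \<noteq> 0" using F_nonzero_at u by blast
  obtain B where B: "finite B" "range (blinfun_apply S) \<subseteq> span B"
    using F_finite_rank[OF S(1)] by (auto simp: finite_rank_def finite_dimensional_def)
  define ev where "ev f = endo_apply f (blinfun_apply S u)" for f
  have lin: "linear ev" by (rule linearI) (simp_all add: ev_def)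
  have inj: "inj_on ev commutant"
  proof (rule inj_onI)
    fix f g assume fg: "f \<in> commutant" "g \<in> commutant" "ev f = ev g"
    then have "f - g = 0"
      using S u range_in_V subspace_diff[OF subspace_commutant]
      by (intro commutant_kernel[of _ "blinfun_apply S u"]) (auto simp: ev_def)
    then show "f = g" by simp
  qed
  have range: "ev f \<in> span B" if "f \<in> commutant" for f
    using commutant_commutes[OF that S(1) u(1)] B by (auto simp: ev_def)
  obtain C where C: "C \<subseteq> commutant" "independent C" "commutant \<subseteq> span C"
    using maximal_independent_subset by metis
  have "span C \<subseteq> commutant" using C subspace_commutant by (simp add: span_minimal)
  then have "independent (ev ` C)"
    using linear_independent_injective_image[OF lin C(2)] inj inj_on_subset by blast
  then have "finite (ev ` C)" using independent_span_bound[OF B(1)] range C by blast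
  then have "finite C" using inj C finite_imageD inj_on_subset by blast
  then show ?thesis using C by (auto simp: finite_dimensional_def)
qed

sublocale finite_dimensional_domain commutant "Endo proj"
proof
  note apply_proj = endo_apply_Endo[OF linear_proj]
  obtain u where u: "u \<in> V" "u \<noteq> 0" using V_nonzero by blast
  show "subspace commutant" by (rule subspace_commutant)
  show "a * b \<in> commutant" if "a \<in> commutant" "b \<in> commutant" for a b
    using that by (auto simp: commutant_def)
  show "Endo proj \<in> commutant"
    by (auto simp: commutant_def apply_proj range_proj range_in_V)
  show "Endo proj \<noteq> 0"
  proof
    assume "Endo proj = 0"
    then have "endo_apply (Endo proj) u = 0" by simp
    then show False using u by (simp add: apply_proj)
  qed
  show "Endo proj * a = a" "a * Endo proj = a" if "a \<in> commutant" for a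
    using that by (auto intro!: endo_eqI simp: apply_proj commutant_range commutant_proj)
  show "a = 0 \<or> b = 0" if ab: "a \<in> commutant" "b \<in> commutant" "a * b = 0" for a b
  proof (cases "endo_apply b u = 0")
    case True
    then show ?thesis using commutant_kernel ab u by blast
  next
    case False
    have "endo_apply (a * b) u = 0" using ab by simp
    then show ?thesis using commutant_kernel[OF ab(1) commutant_V[OF ab(2) u(1)] False] by simp
  qed
  show "finite_dimensional commutant" by (rule commutant_finite_dimensional)
qed

definition restr :: "'a endo \<Rightarrow> 'a \<Rightarrow> 'a" where
  "restr f = restrict (endo_apply f) V"

lemma bij_restr: "bij_betw restr commutant (finite_rank_commutant A)"
proof (rule bij_betwI')
  fix f g assume fg: "f \<in> commutant" "g \<in> commutant"
  show "(restr f = restr g) = (f = g)"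
  proof
    assume *: "restr f = restr g"
    show "f = g"
    proof (rule endo_eqI)
      fix x
      have "restr f (proj x) = restr g (proj x)" using * by simp
      then have "endo_apply f (proj x) = endo_apply g (proj x)"
        by (simp add: restr_def range_proj)
      then show "endo_apply f x = endo_apply g x" using fg by (simp add: commutant_proj)
    qed
  qed simp
next
  fix f assume "f \<in> commutant"
  then show "restr f \<in> finite_rank_commutant A"
    by (auto simp: restr_def finite_rank_commutant_def commutant_V commutant_commutes V_closed range_in_V)
next
  fix g assume g: "g \<in> finite_rank_commutant A"
  then have gV: "\<And>v. v \<in> V \<Longrightarrow> g v \<in> V" and gE: "g \<in> extensional V"
    by (auto simp: finite_rank_commutant_def PiE_def)
  have lin: "linear (\<lambda>x. g (proj x))"
    using g by (intro linearI)
      (simp_all add: finite_rank_commutant_def linear_add[OF linear_proj] linear_scale[OF linear_proj] range_proj)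
  have "Endo (\<lambda>x. g (proj x)) \<in> commutant"
    using g by (simp add: commutant_def endo_apply_Endo[OF lin] range_proj range_in_V gV)
      (simp add: finite_rank_commutant_def)
  moreover have "g = restr (Endo (\<lambda>x. g (proj x)))"
    using gE by (intro ext) (simp add: restr_def endo_apply_Endo[OF lin] restrict_def extensional_def)
  ultimately show "\<exists>f\<in>commutant. g = restr f" by blast
qed

lemma restr_ops:
  "restr (f + g) = (\<lambda>x\<in>V. restr f x + restr g x)"
  "restr (c *\<^sub>R f) = (\<lambda>x\<in>V. c *\<^sub>R restr f x)"
  "g \<in> commutant \<Longrightarrow> restr (f * g) = compose V (restr f) (restr g)"
  by (auto simp: restr_def compose_def commutant_V)

text \<open>This transfers the type of \<open>A\<close>, which refers to operators defined on \<open>V\<close> only, to the commutant above.\<close>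

lemma commutant_isomorphism_iff:
  "(\<exists>\<phi> :: 'd::real_algebra_1 \<Rightarrow> 'a \<Rightarrow> 'a. commutant_isomorphism A \<phi>) \<longleftrightarrow>
   (\<exists>\<psi> :: 'd \<Rightarrow> 'a endo. algebra_iso \<psi> commutant)"
proof
  assume "\<exists>\<psi> :: 'd \<Rightarrow> 'a endo. algebra_iso \<psi> commutant"
  then obtain \<psi> :: "'d \<Rightarrow> 'a endo" where \<psi>: "algebra_iso \<psi> commutant" by blast
  then have b: "bij_betw \<psi> UNIV commutant" by (simp add: algebra_iso_def)
  then have "\<psi> p \<in> commutant" for p by (auto simp: bij_betw_def)
  then have "commutant_isomorphism A (restr \<circ> \<psi>)"
    using \<psi> bij_betw_trans[OF b bij_restr]
    by (simp add: commutant_isomorphism_def algebra_iso_def restr_ops)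
  then show "\<exists>\<phi> :: 'd \<Rightarrow> 'a \<Rightarrow> 'a. commutant_isomorphism A \<phi>" by blast
next
  assume "\<exists>\<phi> :: 'd \<Rightarrow> 'a \<Rightarrow> 'a. commutant_isomorphism A \<phi>"
  then obtain \<phi> :: "'d \<Rightarrow> 'a \<Rightarrow> 'a" where \<phi>: "commutant_isomorphism A \<phi>" by blast
  define \<psi> where "\<psi> p = the_inv_into commutant restr (\<phi> p)" for p
  have b: "bij_betw \<phi> UNIV (finite_rank_commutant A)" using \<phi> by (simp add: commutant_isomorphism_def)
  have b\<psi>: "bij_betw \<psi> UNIV commutant"
    using bij_betw_trans[OF b bij_betw_the_inv_into[OF bij_restr]]
    by (simp add: \<psi>_def[abs_def] comp_def)
  have in_C: "\<psi> p \<in> commutant" for p using b\<psi> by (auto simp: bij_betw_def)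
  have restr_\<psi>: "restr (\<psi> p) = \<phi> p" for p
    using bij_restr b unfolding \<psi>_def
    by (intro f_the_inv_into_f_bij_betw[OF bij_restr]) (auto simp: bij_betw_def)
  have eq: "f = g" if "f \<in> commutant" "g \<in> commutant" "restr f = restr g" for f g
    using bij_restr that by (auto simp: bij_betw_def inj_on_def)
  have "algebra_iso \<psi> commutant"
    unfolding algebra_iso_def
  proof (intro conjI allI b\<psi>)
    fix p q :: 'd and c :: real
    show "\<psi> (p + q) = \<psi> p + \<psi> q"
      using \<phi> by (intro eq) (simp_all add: in_C D_closed restr_ops restr_\<psi> commutant_isomorphism_def)
    show "\<psi> (c *\<^sub>R p) = c *\<^sub>R \<psi> p"
      using \<phi> by (intro eq) (simp_all add: in_C D_closed restr_ops restr_\<psi> commutant_isomorphism_def)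
    show "\<psi> (p * q) = \<psi> p * \<psi> q"
      using \<phi> by (intro eq) (simp_all add: in_C D_closed restr_ops restr_\<psi> commutant_isomorphism_def)
  qed
  then show "\<exists>\<psi> :: 'd \<Rightarrow> 'a endo. algebra_iso \<psi> commutant" by blast
qed

end

section \<open>Bases of the three division algebras\<close>

lemma independent_complex_basis: "independent_family {1..2} (\<lambda>i. if i = 1 then 1 else \<i>)"
proof -
  have "{1..2} = {1, 2 :: nat}" by auto
  then show ?thesis by (simp add: independent_family_iff complex_eq_iff)
qed

definition quat_basis :: "nat \<Rightarrow> quat" where
  "quat_basis i = Quat (of_bool (i = 1)) (of_bool (i = 2)) (of_bool (i = 3)) (of_bool (i = 4))"

lemma quat_basis_sum:
  "(\<Sum>i\<in>{1..4}. t i *\<^sub>R quat_basis i) = Quat (t 1) (t 2) (t 3) (t 4)"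
proof -
  have "{1..4} = {1, 2, 3, 4 :: nat}" by auto
  then show ?thesis by (simp add: quat_basis_def scaleR_quat_def plus_quat_def zero_quat_def)
qed

lemma independent_quat_basis: "independent_family {1..4} quat_basis"
  unfolding independent_family_iff[OF finite_atLeastAtMost] quat_basis_sum zero_quat_def quat.inject
proof (intro allI impI ballI)
  fix t :: "nat \<Rightarrow> real" and i :: nat
  assume t: "t 1 = 0 \<and> t 2 = 0 \<and> t 3 = 0 \<and> t 4 = 0" and "i \<in> {1..4}"
  then have "i = 1 \<or> i = 2 \<or> i = 3 \<or> i = 4" by auto
  then show "t i = 0" using t by blast
qed

lemma algebra_iso_independent:
  assumes iso: "algebra_iso \<psi> D" and I: "finite I" "independent_family I b"
  shows "independent_family I (\<lambda>i. \<psi> (b i))"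
  unfolding independent_family_iff[OF I(1)]
proof (intro allI impI)
  fix t assume *: "(\<Sum>i\<in>I. t i *\<^sub>R \<psi> (b i)) = 0"
  have lin: "linear \<psi>" using iso by (intro linearI) (simp_all add: algebra_iso_def)
  have "\<psi> (\<Sum>i\<in>I. t i *\<^sub>R b i) = \<psi> 0"
    using * by (simp add: linear_sum[OF lin] linear_scale[OF lin] linear_0[OF lin])
  then have "(\<Sum>i\<in>I. t i *\<^sub>R b i) = 0"
    using iso by (auto simp: algebra_iso_def bij_betw_def dest: injD)
  then show "\<forall>i\<in>I. t i = 0" using I by (simp add: independent_family_iff)
qed

lemma algebra_iso_span:
  assumes iso: "algebra_iso \<psi> D" and B: "span B = UNIV"
  shows "D \<subseteq> span (\<psi> ` B)"
proof -
  have lin: "linear \<psi>" using iso by (intro linearI) (simp_all add: algebra_iso_def)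
  then show ?thesis using iso B
    by (simp add: linear_span_image[OF lin] algebra_iso_def bij_betw_def)
qed

section \<open>Density from the dimension of the commutant\<close>

context L_algebra_locale
begin

text \<open>Linear independence over \<open>D\<close>, phrased without an action of \<open>D\<close>: the vectors \<open>x\<^sub>i\<close> lie in the
  whole space, on which \<open>D\<close> does not act.\<close>

definition F_independent :: "'i set \<Rightarrow> ('i \<Rightarrow> 'a) \<Rightarrow> bool" where
  "F_independent J x \<longleftrightarrow>
     (\<forall>i\<in>J. \<exists>T\<in>F. blinfun_apply T (x i) \<noteq> 0 \<and> (\<forall>j\<in>J - {i}. blinfun_apply T (x j) = 0))"

text \<open>By \<open>F_orbit\<close> the nonzero value that separates \<open>x\<^sub>i\<close> from the others can be moved to \<open>w\<^sub>i\<close>; then sum over \<open>i\<close>.\<close>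

lemma interpolation:
  assumes J: "finite J" "F_independent J x" and w: "\<And>j. j \<in> J \<Longrightarrow> w j \<in> V"
  shows "\<exists>T\<in>F. \<forall>j\<in>J. blinfun_apply T (x j) = w j"
proof -
  have "\<forall>i\<in>J. \<exists>T. T \<in> F \<and> blinfun_apply T (x i) = w i \<and> (\<forall>j\<in>J - {i}. blinfun_apply T (x j) = 0)"
  proof
    fix i assume i: "i \<in> J"
    obtain T where T: "T \<in> F" "blinfun_apply T (x i) \<noteq> 0" "\<forall>j\<in>J - {i}. blinfun_apply T (x j) = 0"
      using J i by (auto simp: F_independent_def)
    obtain R where R: "R \<in> F" "blinfun_apply R (blinfun_apply T (x i)) = w i"
      using F_orbit[OF T(2) w[OF i]] by blast
    show "\<exists>T. T \<in> F \<and> blinfun_apply T (x i) = w i \<and> (\<forall>j\<in>J - {i}. blinfun_apply T (x j) = 0)"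
      using T R compose_F_left[OF R(1) F_in_A[OF T(1)]]
      by (intro exI[of _ "R o\<^sub>L T"]) (auto simp: blinfun.zero_right)
  qed
  from bchoice[OF this] obtain T where T0: "\<forall>i\<in>J. T i \<in> F \<and> blinfun_apply (T i) (x i) = w i \<and>
      (\<forall>j\<in>J - {i}. blinfun_apply (T i) (x j) = 0)" by (rule exE)
  have T: "\<And>i. i \<in> J \<Longrightarrow> T i \<in> F" "\<And>i. i \<in> J \<Longrightarrow> blinfun_apply (T i) (x i) = w i"
      "\<And>i j. i \<in> J \<Longrightarrow> j \<in> J \<Longrightarrow> j \<noteq> i \<Longrightarrow> blinfun_apply (T i) (x j) = 0"
    using T0 by blast+
  have "(\<Sum>i\<in>J. T i) \<in> F" using subspace_sum[OF subspace_F T(1)] .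
  moreover have "blinfun_apply (\<Sum>i\<in>J. T i) (x j) = w j" if "j \<in> J" for j
  proof -
    have "blinfun_apply (\<Sum>i\<in>J. T i) (x j) = (\<Sum>i\<in>J. blinfun_apply (T i) (x j))"
      by (rule blinfun.sum_left)
    also have "\<dots> = (\<Sum>i\<in>J. if i = j then w j else 0)"
      using T that by (intro sum.cong) auto
    finally show ?thesis using J(1) that by simp
  qed
  ultimately show ?thesis by blast
qed

text \<open>If \<open>S\<close> kills the subfamily \<open>J\<close> but not \<open>x\<^sub>l\<close>, then \<open>S\<close> separates \<open>x\<^sub>l\<close> from \<open>J\<close>, and subtracting \<open>R S\<close> with
  \<open>R S x\<^sub>l = T x\<^sub>l\<close> makes each separating \<open>T\<close> vanish at \<open>x\<^sub>l\<close>; so \<open>J\<close> was not maximal.\<close>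

lemma maximal_F_independent:
  assumes "finite I"
  shows "\<exists>J\<subseteq>I. F_independent J x \<and>
    (\<forall>l\<in>I. \<forall>T\<in>F. (\<forall>j\<in>J. blinfun_apply T (x j) = 0) \<longrightarrow> blinfun_apply T (x l) = 0)"
proof -
  let ?P = "\<lambda>J. J \<subseteq> I \<and> F_independent J x"
  have "?P {}" by (simp add: F_independent_def)
  moreover have "\<forall>J. ?P J \<longrightarrow> card J < Suc (card I)" using assms by (simp add: card_mono less_Suc_eq_le)
  ultimately obtain J where J: "?P J" and max: "\<And>K. ?P K \<Longrightarrow> card K \<le> card J"
    using ex_has_greatest_nat[of ?P "{}" card "Suc (card I)"] by blast
  have fin: "finite J" using J assms finite_subset by blast
  have "blinfun_apply S (x l) = 0" if l: "l \<in> I" and S: "S \<in> F" "\<forall>j\<in>J. blinfun_apply S (x j) = 0" for l S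
  proof (rule ccontr)
    assume nz: "blinfun_apply S (x l) \<noteq> 0"
    then have lJ: "l \<notin> J" using S by blast
    have "F_independent (insert l J) x"
      unfolding F_independent_def
    proof
      fix i assume i: "i \<in> insert l J"
      show "\<exists>T\<in>F. blinfun_apply T (x i) \<noteq> 0 \<and> (\<forall>j\<in>insert l J - {i}. blinfun_apply T (x j) = 0)"
      proof (cases "i = l")
        case True
        then show ?thesis using S nz by blast
      next
        case False
        then have iJ: "i \<in> J" using i by simp
        obtain T where T: "T \<in> F" "blinfun_apply T (x i) \<noteq> 0" "\<forall>j\<in>J - {i}. blinfun_apply T (x j) = 0"
          using J iJ unfolding F_independent_def by blast
        obtain R where R: "R \<in> F" "blinfun_apply R (blinfun_apply S (x l)) = blinfun_apply T (x l)"
          using F_orbit[OF nz range_in_V[OF T(1)]] by blast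
        have "T - (R o\<^sub>L S) \<in> F"
          using T R S by (intro subspace_diff[OF subspace_F] compose_F_left F_in_A)
        moreover have "blinfun_apply (T - (R o\<^sub>L S)) (x i) \<noteq> 0"
          using T S iJ by (simp add: blinfun.diff_left blinfun.zero_right)
        moreover have "\<forall>j\<in>insert l J - {i}. blinfun_apply (T - (R o\<^sub>L S)) (x j) = 0"
          using T R S by (auto simp: blinfun.diff_left blinfun.zero_right)
        ultimately show ?thesis by blast
      qed
    qed
    then have "card (insert l J) \<le> card J" using J l by (intro max) auto
    then show False using fin lJ by simp
  qed
  then show ?thesis using J by blast
qed

text \<open>The heart of Jacobson's argument: \<open>T y\<close> depends only on the values \<open>T x\<^sub>j\<close>, so \<open>c\<^sub>j\<close> may send \<open>v\<close> to \<open>T y\<close> for any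
  \<open>T \<in> F\<close> with \<open>T x\<^sub>j = v\<close> that kills the other \<open>x\<^sub>i\<close>. Independence of the choice makes \<open>c\<^sub>j\<close> linear and
  \<open>F\<close>-equivariant.\<close>

lemma commutant_coefficients:
  assumes J: "finite J" "F_independent J x"
    and det: "\<And>T. T \<in> F \<Longrightarrow> (\<forall>j\<in>J. blinfun_apply T (x j) = 0) \<Longrightarrow> blinfun_apply T y = 0"
  shows "\<exists>c. (\<forall>j\<in>J. c j \<in> commutant) \<and>
    (\<forall>T\<in>F. blinfun_apply T y = (\<Sum>j\<in>J. endo_apply (c j) (blinfun_apply T (x j))))"
proof -
  have det2: "blinfun_apply S y = blinfun_apply T y"
    if "S \<in> F" "T \<in> F" "\<And>j. j \<in> J \<Longrightarrow> blinfun_apply S (x j) = blinfun_apply T (x j)" for S T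
    using det[of "S - T"] that subspace_diff[OF subspace_F] by (auto simp: blinfun.diff_left)
  have "\<exists>T\<in>F. \<forall>i\<in>J. blinfun_apply T (x i) = (if i = j then proj v else 0)" for j v
    using J by (intro interpolation) (auto simp: range_proj V_closed)
  then obtain T where TF: "\<And>j v. T j v \<in> F"
      and T: "\<And>i j v. i \<in> J \<Longrightarrow> blinfun_apply (T j v) (x i) = (if i = j then proj v else 0)"
    by metis
  define c where "c j = Endo (\<lambda>v. blinfun_apply (T j v) y)" for j
  have lin: "linear (\<lambda>v. blinfun_apply (T j v) y)" for j
  proof (rule linearI)
    fix v w and r :: real
    have "blinfun_apply (T j (v + w)) y = blinfun_apply (T j v + T j w) y"
      by (rule det2) (simp_all add: TF T blinfun.add_left subspace_add[OF subspace_F] linear_add[OF linear_proj])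
    then show "blinfun_apply (T j (v + w)) y = blinfun_apply (T j v) y + blinfun_apply (T j w) y"
      by (simp add: blinfun.add_left)
    have "blinfun_apply (T j (r *\<^sub>R v)) y = blinfun_apply (r *\<^sub>R T j v) y"
      by (rule det2) (simp_all add: TF T blinfun.scaleR_left subspace_mul[OF subspace_F] linear_scale[OF linear_proj])
    then show "blinfun_apply (T j (r *\<^sub>R v)) y = r *\<^sub>R blinfun_apply (T j v) y"
      by (simp add: blinfun.scaleR_left)
  qed
  note c = endo_apply_Endo[OF lin, folded c_def]
  have "c j \<in> commutant" for j
    unfolding commutant_def mem_Collect_eq c
  proof (intro conjI ballI allI)
    show "blinfun_apply (T j (proj v)) y = blinfun_apply (T j v) y" for v
      by (rule det2) (simp_all add: TF T range_proj)
    show "blinfun_apply (T j v) y \<in> V" for v by (rule range_in_V[OF TF])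
    show "blinfun_apply (T j (blinfun_apply S v)) y = blinfun_apply S (blinfun_apply (T j v) y)"
      if "S \<in> F" "v \<in> V" for S v
    proof -
      have "blinfun_apply (T j (blinfun_apply S v)) y = blinfun_apply (S o\<^sub>L T j v) y"
        using that
        by (intro det2) (simp_all add: TF T compose_F_left F_in_A range_in_V blinfun.zero_right)
      then show ?thesis by simp
    qed
  qed
  moreover have "blinfun_apply S y = (\<Sum>j\<in>J. endo_apply (c j) (blinfun_apply S (x j)))" if S: "S \<in> F" for S
  proof -
    have "blinfun_apply S y = blinfun_apply (\<Sum>j\<in>J. T j (blinfun_apply S (x j))) y"
    proof (rule det2[OF S])
      show "(\<Sum>j\<in>J. T j (blinfun_apply S (x j))) \<in> F" using subspace_sum[OF subspace_F TF] .
      fix i assume i: "i \<in> J"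
      have "blinfun_apply (\<Sum>j\<in>J. T j (blinfun_apply S (x j))) (x i) =
          (\<Sum>j\<in>J. if j = i then blinfun_apply S (x i) else 0)"
        unfolding blinfun.sum_left using i S by (intro sum.cong) (auto simp: T range_in_V)
      then show "blinfun_apply S (x i) = blinfun_apply (\<Sum>j\<in>J. T j (blinfun_apply S (x j))) (x i)"
        using i J by simp
    qed
    then show ?thesis by (simp add: blinfun.sum_left c)
  qed
  ultimately show ?thesis by blast
qed

text \<open>Over a maximal \<open>J\<close>, each \<open>x\<^sub>l\<close> is described by \<open>card B * card J\<close> real coefficients. With more vectors than
  that, a nontrivial relation between the coefficient vectors gives one between the \<open>x\<^sub>l\<close>, since only \<open>0\<close> is
  killed by all of \<open>F\<close>.\<close>

lemma large_F_independent_subfamily: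
  assumes I: "finite I" "independent_family I x" and B: "finite B" "commutant \<subseteq> span B"
  shows "\<exists>J\<subseteq>I. F_independent J x \<and> card I \<le> card B * card J"
proof -
  obtain J where J: "J \<subseteq> I" "F_independent J x"
      and det: "\<And>l T. l \<in> I \<Longrightarrow> T \<in> F \<Longrightarrow> (\<forall>j\<in>J. blinfun_apply T (x j) = 0) \<Longrightarrow> blinfun_apply T (x l) = 0"
    using maximal_F_independent[OF I(1)] by metis
  have fin: "finite J" using J I finite_subset by blast
  have "\<exists>a. \<forall>T\<in>F. blinfun_apply T (x l) =
      (\<Sum>(j, b)\<in>J \<times> B. a (j, b) *\<^sub>R endo_apply b (blinfun_apply T (x j)))" if l: "l \<in> I" for l
  proof -
    obtain c where c: "\<forall>j\<in>J. c j \<in> commutant"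
        "\<forall>T\<in>F. blinfun_apply T (x l) = (\<Sum>j\<in>J. endo_apply (c j) (blinfun_apply T (x j)))"
      using commutant_coefficients[OF fin J(2) det[OF l]] by blast
    have "\<forall>j\<in>J. \<exists>a. c j = (\<Sum>b\<in>B. a b *\<^sub>R b)"
      using c(1) B span_finite[OF B(1)] by blast
    then obtain a where a: "\<And>j. j \<in> J \<Longrightarrow> c j = (\<Sum>b\<in>B. a j b *\<^sub>R b)" by metis
    have "blinfun_apply T (x l) = (\<Sum>(j, b)\<in>J \<times> B. a j b *\<^sub>R endo_apply b (blinfun_apply T (x j)))"
      if "T \<in> F" for T
      using c(2) that by (simp add: a endo_apply_sum sum.cartesian_product)
    then show ?thesis by (intro exI[of _ "\<lambda>(j, b). a j b"]) simp
  qed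
  then obtain a where a: "\<And>l T. l \<in> I \<Longrightarrow> T \<in> F \<Longrightarrow> blinfun_apply T (x l) =
      (\<Sum>p\<in>J \<times> B. a l p *\<^sub>R endo_apply (snd p) (blinfun_apply T (x (fst p))))"
    by (simp only: case_prod_unfold prod.collapse) metis
  have "\<not> card (J \<times> B) < card I"
  proof
    assume "card (J \<times> B) < card I"
    then obtain t where t: "\<exists>l\<in>I. t l \<noteq> 0" "\<forall>p\<in>J \<times> B. (\<Sum>l\<in>I. t l * a l p) = 0"
      using homogeneous_system_nontrivial[of "J \<times> B" I a] fin B I by auto
    have "blinfun_apply T (\<Sum>l\<in>I. t l *\<^sub>R x l) = 0" if T: "T \<in> F" for T
    proof -
      have "blinfun_apply T (\<Sum>l\<in>I. t l *\<^sub>R x l) =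
          (\<Sum>l\<in>I. \<Sum>p\<in>J \<times> B. (t l * a l p) *\<^sub>R endo_apply (snd p) (blinfun_apply T (x (fst p))))"
        using T by (simp add: blinfun.sum_right blinfun.scaleR_right a scaleR_sum_right)
      also have "\<dots> = (\<Sum>p\<in>J \<times> B. (\<Sum>l\<in>I. t l * a l p) *\<^sub>R endo_apply (snd p) (blinfun_apply T (x (fst p))))"
        by (subst sum.swap) (simp only: scaleR_sum_left)
      also have "\<dots> = 0" using t(2) by (intro sum.neutral) simp
      finally show ?thesis .
    qed
    then have "(\<Sum>l\<in>I. t l *\<^sub>R x l) = 0" using F_nonzero_at by blast
    then show False using I t(1) by (auto simp: independent_family_iff)
  qed
  then show ?thesis using J by (auto simp: card_cartesian_product mult.commute)
qed

lemma approximate_interpolation: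
  assumes "finite J" "F_independent J x" "\<epsilon> > 0"
  shows "\<exists>T\<in>A. \<forall>j\<in>J. norm (y j - blinfun_apply T (x j)) < \<epsilon>"
proof -
  have "\<forall>j. \<exists>v. v \<in> V \<and> norm (y j - v) < \<epsilon>" using V_dense[OF assms(3)] by blast
  then obtain w where w: "\<And>j. w j \<in> V" "\<And>j. norm (y j - w j) < \<epsilon>"
    using choice[of "\<lambda>j v. v \<in> V \<and> norm (y j - v) < \<epsilon>"] by blast
  obtain T where "T \<in> F" "\<forall>j\<in>J. blinfun_apply T (x j) = w j"
    using interpolation[OF assms(1,2), of w] w(1) by blast
  then show ?thesis using w(2) F_in_A by (intro bexI[of _ T]) auto
qed

lemma frac_dense_if_commutant_dim_le:
  assumes B: "finite B" "commutant \<subseteq> span B" "card B \<le> k"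
  shows "frac_dense k A"
  unfolding frac_dense_def
proof (intro allI impI)
  fix \<epsilon> :: real and n :: nat and x y :: "nat \<Rightarrow> 'a"
  assume eps: "\<epsilon> > 0" and n: "1 \<le> n" and ind: "independent_family {1..k * n} x"
  obtain J where J: "J \<subseteq> {1..k * n}" "F_independent J x" "card {1..k * n} \<le> card B * card J"
    using large_F_independent_subfamily[OF _ ind B(1,2)] by auto
  have fin: "finite J" using J finite_subset by blast
  have "k > 0"
  proof (rule ccontr)
    assume "\<not> k > 0"
    then have "commutant \<subseteq> {0}" using B by simp
    then show False using unit_in unit_nonzero by blast
  qed
  have "k * n \<le> card B * card J" using J(3) by simp
  also have "\<dots> \<le> k * card J" using B(3) by simp
  finally have "n \<le> card J" using \<open>k > 0\<close> by simp
  then obtain j where j: "inj_on j {1..n}" "j ` {1..n} \<subseteq> J"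
    using card_le_inj[of "{1..n}" J] fin by auto
  obtain T where T: "T \<in> A"
      "\<forall>i\<in>J. norm (y (the_inv_into {1..n} j i) - blinfun_apply T (x i)) < \<epsilon>"
    using approximate_interpolation[OF fin J(2) eps] by meson
  have "\<forall>i\<in>{1..n}. norm (y i - blinfun_apply T (x (j i))) < \<epsilon>"
    using T(2) j by (metis image_subset_iff the_inv_into_f_f)
  moreover have "j \<in> {1..n} \<rightarrow> {1..k * n}" using j J by blast
  ultimately show "\<exists>j\<in>{1..n} \<rightarrow> {1..k * n}. \<exists>T\<in>A. \<forall>i\<in>{1..n}. norm (y i - blinfun_apply T (x (j i))) < \<epsilon>"
    using T(1) by blast
qed

lemma dense_if_commutant_dim_le_1:
  assumes B: "finite B" "commutant \<subseteq> span B" "card B \<le> 1"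
  shows "dense_algebra A"
  unfolding dense_algebra_def
proof (intro allI impI)
  fix \<epsilon> :: real and n :: nat and x y :: "nat \<Rightarrow> 'a"
  assume eps: "\<epsilon> > 0" and ind: "independent_family {1..n} x"
  obtain J where J: "J \<subseteq> {1..n}" "F_independent J x" "card {1..n} \<le> card B * card J"
    using large_F_independent_subfamily[OF _ ind B(1,2)] by auto
  have "card B * card J \<le> 1 * card J" using B(3) by (rule mult_le_mono1)
  then have "card {1..n} \<le> card J" using J(3) by linarith
  then have "J = {1..n}" using J(1) by (simp add: card_seteq)
  then show "\<exists>T\<in>A. \<forall>i\<in>{1..n}. norm (blinfun_apply T (x i) - y i) < \<epsilon>"
    using approximate_interpolation[of J x \<epsilon> y] J(2) eps by (simp add: norm_minus_commute)
qed

text \<open>With \<open>w = S T u\<close> the two vectors are \<open>q w\<close> and \<open>p w\<close>, and \<open>q w = q p\<^sup>-\<^sup>1 (p w)\<close>. The endomorphism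
  \<open>q p\<^sup>-\<^sup>1\<close> is bounded on the finite-dimensional range of \<open>S\<close>, although it may be unbounded on \<open>V\<close>.\<close>

lemma commutant_comparison:
  assumes S: "S \<in> F" and u: "u \<in> V" and pq: "p \<in> commutant" "p \<noteq> 0" "q \<in> commutant"
  shows "\<exists>C\<ge>0. \<forall>T\<in>A. norm (blinfun_apply S (blinfun_apply T (endo_apply q u))) \<le>
    C * norm (blinfun_apply S (blinfun_apply T (endo_apply p u)))"
proof -
  obtain g where g: "g \<in> commutant" "g * p = Endo proj" using left_inverse pq by blast
  obtain B where B: "finite B" "range (blinfun_apply S) \<subseteq> span B"
    using F_finite_rank[OF S] by (auto simp: finite_rank_def finite_dimensional_def)
  obtain C where C: "C \<ge> 0" "\<And>v. v \<in> span B \<Longrightarrow> norm (endo_apply (q * g) v) \<le> C * norm v"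
    using linear_bounded_on_finite_span[OF B(1) linear_endo_apply] by blast
  have "blinfun_apply S (blinfun_apply T (endo_apply q u)) =
      endo_apply (q * g) (blinfun_apply S (blinfun_apply T (endo_apply p u)))" if T: "T \<in> A" for T
  proof -
    define w where "w = blinfun_apply (S o\<^sub>L T) u"
    have ST: "S o\<^sub>L T \<in> F" using S T by (rule compose_F_left)
    have d: "blinfun_apply S (blinfun_apply T (endo_apply d u)) = endo_apply d w" if "d \<in> commutant" for d
      using commutant_commutes[OF that ST u] by (simp add: w_def)
    have "endo_apply (q * g) (endo_apply p w) = endo_apply q (endo_apply (g * p) w)" by simp
    also have "\<dots> = endo_apply q w"
      using pq by (simp only: g endo_apply_Endo[OF linear_proj] commutant_proj)
    finally show ?thesis using d pq by simp
  qed
  then have "norm (blinfun_apply S (blinfun_apply T (endo_apply q u))) \<le>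
      C * norm (blinfun_apply S (blinfun_apply T (endo_apply p u)))" if "T \<in> A" for T
    using C(2)[of "blinfun_apply S (blinfun_apply T (endo_apply p u))"] B(2) that by auto
  then show ?thesis using C(1) by blast
qed

text \<open>Apply \<open>1/l\<close>-density with \<open>n = 2\<close> to the vectors \<open>d\<^sub>i u\<close> and to the targets \<open>0\<close> and \<open>z\<close>, where \<open>S z \<noteq> 0\<close>. Whichever
  indices are chosen, \<open>commutant_comparison\<close> bounds the value near \<open>S z\<close> by a multiple of the value
  near \<open>0\<close>.\<close>

lemma not_frac_dense_if_commutant_large:
  assumes d: "\<And>i. i \<in> {1..l * 2} \<Longrightarrow> d i \<in> commutant" and ind: "independent_family {1..l * 2} d"
  shows "\<not> frac_dense l A"
proof
  assume dense: "frac_dense l A"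
  let ?I = "{1..l * 2}"
  obtain u where u: "u \<in> V" "u \<noteq> 0" using V_nonzero by blast
  define x where "x i = endo_apply (d i) u" for i
  have d_nz: "d i \<noteq> 0" if "i \<in> ?I" for i
    using ind that unfolding independent_family_def
    by (metis dependent_zero image_eqI)
  have ind_x: "independent_family ?I x"
    unfolding independent_family_iff[OF finite_atLeastAtMost]
  proof (intro allI impI)
    fix t assume "(\<Sum>i\<in>?I. t i *\<^sub>R x i) = 0"
    then have "endo_apply (\<Sum>i\<in>?I. t i *\<^sub>R d i) u = 0" by (simp add: endo_apply_sum x_def)
    moreover have "(\<Sum>i\<in>?I. t i *\<^sub>R d i) \<in> commutant"
      using d by (intro subspace_sum[OF subspace_commutant]) (simp add: D_closed)
    ultimately have "(\<Sum>i\<in>?I. t i *\<^sub>R d i) = 0" using commutant_kernel u by blast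
    then show "\<forall>i\<in>?I. t i = 0" using ind by (simp add: independent_family_iff)
  qed
  obtain S where S: "S \<in> F" "S \<noteq> 0" using nonzero_in_F by blast
  then obtain z where z: "blinfun_apply S z \<noteq> 0" by (metis blinfun_eqI zero_blinfun.rep_eq)
  have "\<forall>p\<in>?I. \<forall>q\<in>?I. \<exists>C\<ge>0. \<forall>T\<in>A. norm (blinfun_apply S (blinfun_apply T (x q))) \<le>
      C * norm (blinfun_apply S (blinfun_apply T (x p)))"
    unfolding x_def using commutant_comparison[OF S(1) u(1) d d_nz d] by blast
  then obtain C where C0: "\<And>p q. p \<in> ?I \<Longrightarrow> q \<in> ?I \<Longrightarrow> C p q \<ge> 0"
      and C: "\<And>p q T. p \<in> ?I \<Longrightarrow> q \<in> ?I \<Longrightarrow> T \<in> A \<Longrightarrow>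
        norm (blinfun_apply S (blinfun_apply T (x q))) \<le>
        C p q * norm (blinfun_apply S (blinfun_apply T (x p)))"
    by metis
  define M where "M = (\<Sum>r\<in>?I \<times> ?I. C (fst r) (snd r))"
  have M: "C p q \<le> M" if "p \<in> ?I" "q \<in> ?I" for p q
    unfolding M_def using that C0 member_le_sum[of "(p, q)" "?I \<times> ?I" "\<lambda>r. C (fst r) (snd r)"]
    by auto
  have M0: "M \<ge> 0" unfolding M_def using C0 by (intro sum_nonneg) auto
  define K where "K = norm S + 1"
  have K: "K > 0" "\<And>v. norm (blinfun_apply S v) \<le> K * norm v"
  proof -
    show "K > 0" by (simp add: K_def add_nonneg_pos)
    show "norm (blinfun_apply S v) \<le> K * norm v" for v
      using norm_blinfun[of S v] by (simp add: K_def algebra_simps add_increasing)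
  qed
  \<comment> \<open>The two errors contribute less than \<open>K * \<epsilon>\<close> and at most \<open>M * (K * \<epsilon>)\<close> to the norm of \<open>S z\<close>.\<close>
  define \<epsilon> where "\<epsilon> = norm (blinfun_apply S z) / (K * (1 + M))"
  have "\<epsilon> > 0" using z K M0 by (simp add: \<epsilon>_def)
  define y where "y i = (if i = 1 then 0 else z)" for i :: nat
  obtain j T where j: "j \<in> {1..2} \<rightarrow> ?I" and T: "T \<in> A"
      "\<forall>i\<in>{1..2}. norm (y i - blinfun_apply T (x (j i))) < \<epsilon>"
    using dense[unfolded frac_dense_def, rule_format, OF \<open>\<epsilon> > 0\<close>, of 2 x y] ind_x by auto
  have jI: "j 1 \<in> ?I" "j 2 \<in> ?I" using j by auto
  have 1: "norm (blinfun_apply T (x (j 1))) < \<epsilon>" and 2: "norm (z - blinfun_apply T (x (j 2))) < \<epsilon>"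
    using T(2)[rule_format, of 1] T(2)[rule_format, of 2] by (simp_all add: y_def)
  have "norm (blinfun_apply S (blinfun_apply T (x (j 2)))) \<le>
      C (j 1) (j 2) * norm (blinfun_apply S (blinfun_apply T (x (j 1))))"
    using C jI T by blast
  also have "\<dots> \<le> M * (K * \<epsilon>)"
  proof (rule mult_mono[OF M[OF jI]])
    have "norm (blinfun_apply S (blinfun_apply T (x (j 1)))) \<le> K * norm (blinfun_apply T (x (j 1)))"
      by (rule K)
    also have "\<dots> \<le> K * \<epsilon>" using 1 K by simp
    finally show "norm (blinfun_apply S (blinfun_apply T (x (j 1)))) \<le> K * \<epsilon>" .
  qed (use M0 in auto)
  finally have near: "norm (blinfun_apply S (blinfun_apply T (x (j 2)))) \<le> M * (K * \<epsilon>)" .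
  have "norm (blinfun_apply S z) \<le>
      norm (blinfun_apply S (z - blinfun_apply T (x (j 2)))) + norm (blinfun_apply S (blinfun_apply T (x (j 2))))"
    using norm_triangle_sub[of "blinfun_apply S z" "blinfun_apply S (blinfun_apply T (x (j 2)))"]
    by (simp add: blinfun.diff_right)
  moreover have "norm (blinfun_apply S (z - blinfun_apply T (x (j 2)))) \<le> K * norm (z - blinfun_apply T (x (j 2)))"
    by (rule K)
  moreover have "K * norm (z - blinfun_apply T (x (j 2))) < K * \<epsilon>" using 2 K by simp
  ultimately have "norm (blinfun_apply S z) < K * \<epsilon> + M * (K * \<epsilon>)" using near by linarith
  also have "\<dots> = K * (1 + M) * \<epsilon>" by (simp add: algebra_simps)
  also have "\<dots> = norm (blinfun_apply S z)" using K M0 by (simp add: \<epsilon>_def)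
  finally show False by simp
qed

lemma dense_imp_frac_dense_1:
  assumes "dense_algebra A"
  shows "frac_dense 1 A"
  unfolding frac_dense_def
proof (intro allI impI)
  fix \<epsilon> :: real and n :: nat and x y :: "nat \<Rightarrow> 'a"
  assume eps: "\<epsilon> > 0" "1 \<le> n" "independent_family {1..1 * n} x"
  then obtain T where "T \<in> A" "\<forall>i\<in>{1..n}. norm (blinfun_apply T (x i) - y i) < \<epsilon>"
    using assms[unfolded dense_algebra_def, rule_format, OF eps(1), of n x y] by auto
  then show "\<exists>j\<in>{1..n} \<rightarrow> {1..1 * n}. \<exists>T\<in>A. \<forall>i\<in>{1..n}. norm (y i - blinfun_apply T (x (j i))) < \<epsilon>"
    by (intro bexI[of _ id] bexI[of _ T]) (auto simp: norm_minus_commute)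
qed

section \<open>The three types\<close>

lemma not_frac_dense_if_iso:
  fixes b :: "nat \<Rightarrow> 'd::real_algebra_1" and \<psi> :: "'d \<Rightarrow> 'a endo"
  assumes iso: "algebra_iso \<psi> commutant" and b: "independent_family {1..l * 2} b"
  shows "\<not> frac_dense l A"
proof (rule not_frac_dense_if_commutant_large)
  show "independent_family {1..l * 2} (\<lambda>i. \<psi> (b i))"
    using algebra_iso_independent[OF iso _ b] by simp
qed (use iso in \<open>auto simp: algebra_iso_def bij_betw_def\<close>)

lemma real_type_dense:
  assumes "real_type A"
  shows "dense_algebra A"
proof -
  obtain \<psi> :: "real \<Rightarrow> 'a endo" where \<psi>: "algebra_iso \<psi> commutant"
    using assms unfolding real_type_def commutant_isomorphism_iff by blast
  have "span {1 :: real} = UNIV" by (auto simp: span_singleton)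
  from algebra_iso_span[OF \<psi> this] show ?thesis
    by (intro dense_if_commutant_dim_le_1[of "\<psi> ` {1}"]) auto
qed

lemma complex_type_density:
  assumes "complex_type A"
  shows "frac_dense 2 A" "\<not> dense_algebra A"
proof -
  obtain \<psi> :: "complex \<Rightarrow> 'a endo" where \<psi>: "algebra_iso \<psi> commutant"
    using assms unfolding complex_type_def commutant_isomorphism_iff by blast
  have "z \<in> span {1, \<i>}" for z
  proof -
    have "z = Re z *\<^sub>R 1 + Im z *\<^sub>R \<i>" by (simp add: complex_eq_iff)
    then show ?thesis by (metis insertCI span_add span_base span_scale)
  qed
  then have "span {1, \<i>} = UNIV" by auto
  from algebra_iso_span[OF \<psi> this] show "frac_dense 2 A"
    by (intro frac_dense_if_commutant_dim_le[of "\<psi> ` {1, \<i>}"] card_image_le[THEN order_trans]) auto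
  show "\<not> dense_algebra A"
    using not_frac_dense_if_iso[OF \<psi>, of 1] independent_complex_basis dense_imp_frac_dense_1 by auto
qed

lemma quaternion_type_density:
  assumes "quaternion_type A"
  shows "frac_dense 4 A" "\<not> dense_algebra A" "\<not> frac_dense 2 A"
proof -
  obtain \<psi> :: "quat \<Rightarrow> 'a endo" where \<psi>: "algebra_iso \<psi> commutant"
    using assms unfolding quaternion_type_def commutant_isomorphism_iff by blast
  have "q \<in> span (quat_basis ` {1..4})" for q
  proof -
    have "q = (\<Sum>i\<in>{1..4}. [q_re q, q_i q, q_j q, q_k q] ! (i - 1) *\<^sub>R quat_basis i)"
      unfolding quat_basis_sum by simp
    then show ?thesis by (metis (no_types, lifting) imageI span_base span_scale span_sum)
  qed
  then have "span (quat_basis ` {1..4}) = UNIV" by auto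
  from algebra_iso_span[OF \<psi> this] show "frac_dense 4 A"
    by (intro frac_dense_if_commutant_dim_le[of "\<psi> ` quat_basis ` {1..4}"]
        card_image_le[THEN order_trans]) auto
  show "\<not> frac_dense 2 A"
    using not_frac_dense_if_iso[OF \<psi>, of 2] independent_quat_basis by simp
  have "independent_family {1..2} quat_basis"
    using independent_family_subset[OF independent_quat_basis] by simp
  then show "\<not> dense_algebra A"
    using not_frac_dense_if_iso[OF \<psi>, of 1] dense_imp_frac_dense_1 by auto
qed

lemma type_trichotomy: "real_type A \<or> complex_type A \<or> quaternion_type A"
  using frobenius unfolding real_type_def complex_type_def quaternion_type_def commutant_isomorphism_iff .

end

theorem theorem2p12:
  fixes A :: "('a::banach \<Rightarrow>\<^sub>L 'a) set"
  assumes "\<not> finite_dimensional (UNIV :: 'a set)"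
    and "L_algebra A"
  shows "(dense_algebra A \<longleftrightarrow> real_type A) \<and>
    (frac_dense 2 A \<and> \<not> dense_algebra A \<longleftrightarrow> complex_type A) \<and>
    (frac_dense 4 A \<and> \<not> dense_algebra A \<and> \<not> frac_dense 2 A \<longleftrightarrow> quaternion_type A)"
proof -
  interpret L_algebra_locale A using assms(2) by unfold_locales
  show ?thesis
    using type_trichotomy real_type_dense complex_type_density quaternion_type_density by blast
qed

end
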